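(* For every countable ordinal $1\le\alpha<\omega_1$, if $\sqsubseteq_\alpha$ is Borel then $\sqsubseteq_\alpha\ <_B\ \sqsubseteq_{\alpha+1}$.
   Context: For $1\le\alpha<\omega_1$ fix a countable $D_\alpha\subseteq[0,\infty)$ with $0\in D_\alpha$ of order type $\alpha$; $\mathcal U_\alpha$ is the standard Borel set of nonempty closed subsets of the Urysohn space $\mathbb U$ (Effros Borel structure) which are ultrametric with all realized distances in $D_\alpha$, and $\sqsubseteq_\alpha$ is isometric embeddability on $\mathcal U_\alpha$ (up to Borel bireducibility independent of the choice of $D_\alpha$). "Borel" means Borel as a subset of $\mathcal U_\alpha\times\mathcal U_\alpha$. $R<_B S$ means $R$ Borel reduces to $S$ but not conversely. *)

theory Defs
  imports "HOL-Analysis.Analysis"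
begin

section \<open>Ordinals and distance sets\<close>

text \<open>
  An ordinal is represented by a well-order (a reflexive relation in the sense of
  \<^const>\<open>Well_order\<close>), and "having order type" means being isomorphic (\<^const>\<open>ordIso\<close>) to it.
  The successor adds a new largest element \<^const>\<open>None\<close>.
\<close>

definition ord_succ :: "'o rel \<Rightarrow> 'o option rel" where
  "ord_succ r =
     {(Some a, Some b) | a b. (a, b) \<in> r} \<union> {(Some a, None) | a. a \<in> Field r} \<union> {(None, None)}"

lemma Field_ord_succ: "Field (ord_succ r) = insert None (Some ` Field r)"
  by (auto simp: ord_succ_def Field_def)

lemma Well_order_ord_succ:
  assumes "Well_order r"
  shows "Well_order (ord_succ r)"
proof -
  have refl: "Refl r" and tr: "trans r" and anti: "antisym r" and tot: "Total r"
    and w: "wf (r - Id)"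
    using assms by (auto simp: order_on_defs)
  have fld: "a \<in> Field r \<and> b \<in> Field r" if "(a, b) \<in> r" for a b
    using that by (auto simp: Field_def)
  have "Refl (ord_succ r)"
    unfolding refl_on_def Field_ord_succ
    using refl by (auto simp: ord_succ_def refl_on_def)
  moreover have "ord_succ r \<subseteq> Field (ord_succ r) \<times> Field (ord_succ r)"
    by (auto simp: Field_def)
  moreover have "trans (ord_succ r)"
    unfolding trans_def ord_succ_def using fld by (auto dest: transD[OF tr])
  moreover have "antisym (ord_succ r)"
    unfolding antisym_def ord_succ_def by (auto dest: antisymD[OF anti])
  moreover have "Total (ord_succ r)"
    unfolding total_on_def Field_ord_succ using tot
    by (auto simp: ord_succ_def total_on_def)
  moreover have "wf (ord_succ r - Id)"
  proof (rule wfUNIVI)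
    fix P :: "'a option \<Rightarrow> bool" and x
    assume step: "\<forall>x. (\<forall>y. (y, x) \<in> ord_succ r - Id \<longrightarrow> P y) \<longrightarrow> P x"
    have some: "P (Some a)" for a
      using w
    proof (induction a rule: wf_induct_rule)
      case (less a)
      show ?case
        by (rule step[rule_format]) (auto simp: ord_succ_def intro: less)
    qed
    have "P None"
      by (rule step[rule_format]) (auto simp: ord_succ_def some)
    with some show "P x" by (cases x) auto
  qed
  ultimately show ?thesis
    by (auto simp: order_on_defs)
qed

definition distance_set :: "'o rel \<Rightarrow> real set \<Rightarrow> bool" where
  "distance_set r D \<longleftrightarrow>
     countable D \<and> D \<subseteq> {0..} \<and> 0 \<in> D \<and> ({(x, y). x \<in> D \<and> y \<in> D \<and> x \<le> y}, r) \<in> ordIso"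

section \<open>The Urysohn space\<close>

text \<open>
  The Urysohn space is the Polish metric space, unique up to isometry, which contains an isometric
  copy of every separable metric space and is ultrahomogeneous.  Completeness and separability are
  the type class \<^class>\<open>polish_space\<close>.  In the universality clause it suffices to quantify over
  metric spaces whose points are reals: a separable metric space has at most continuum many points,
  and the metric \<open>d\<close> is arbitrary.
\<close>

definition urysohn_space :: "'u::polish_space itself \<Rightarrow> bool" where
  "urysohn_space _ \<longleftrightarrow>
     (\<forall>(M :: real set) d. Metric_space M d \<and> separable_space (Metric_space.mtopology M d) \<longrightarrow>
        (\<exists>f :: real \<Rightarrow> 'u. \<forall>x\<in>M. \<forall>y\<in>M. dist (f x) (f y) = d x y)) \<and>
     (\<forall>(A :: 'u set) (g :: 'u \<Rightarrow> 'u). finite A \<and> (\<forall>x\<in>A. \<forall>y\<in>A. dist (g x) (g y) = dist x y) \<longrightarrow>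
        (\<exists>h :: 'u \<Rightarrow> 'u. surj h \<and> (\<forall>x y. dist (h x) (h y) = dist x y) \<and> (\<forall>x\<in>A. h x = g x)))"

section \<open>Spaces of ultrametric subspaces\<close>

text \<open>Measures serve here only as carriers of a set with a \<open>\<sigma>\<close>-algebra.\<close>

definition effros :: "'u::topological_space set measure" where
  "effros = sigma {F. closed F} {{F. closed F \<and> F \<inter> V \<noteq> {}} | V. open V}"

definition ultrametric_on :: "'u::metric_space set \<Rightarrow> bool" where
  "ultrametric_on X \<longleftrightarrow> (\<forall>x\<in>X. \<forall>y\<in>X. \<forall>z\<in>X. dist x z \<le> max (dist x y) (dist y z))"

definition ultra_space :: "real set \<Rightarrow> 'u::metric_space set measure" where
  "ultra_space D =
     restrict_space effros
       {X. closed X \<and> X \<noteq> {} \<and> ultrametric_on X \<and> (\<forall>x\<in>X. \<forall>y\<in>X. dist x y \<in> D)}"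

definition isometrically_embeds :: "'u::metric_space set \<Rightarrow> 'u set \<Rightarrow> bool"  (infix "\<sqsubseteq>\<^sub>i" 50) where
  "X \<sqsubseteq>\<^sub>i Y \<longleftrightarrow> (\<exists>f. f ` X \<subseteq> Y \<and> (\<forall>x\<in>X. \<forall>y\<in>X. dist (f x) (f y) = dist x y))"

section \<open>Borel reducibility\<close>

text \<open>In what follows a relation is considered only on the points of the given measurable space.\<close>

definition borel_relation :: "'a measure \<Rightarrow> ('a \<Rightarrow> 'a \<Rightarrow> bool) \<Rightarrow> bool" where
  "borel_relation M R \<longleftrightarrow> {(x, y). x \<in> space M \<and> y \<in> space M \<and> R x y} \<in> sets (M \<Otimes>\<^sub>M M)"

definition borel_reducible ::
    "'a measure \<Rightarrow> ('a \<Rightarrow> 'a \<Rightarrow> bool) \<Rightarrow> 'b measure \<Rightarrow> ('b \<Rightarrow> 'b \<Rightarrow> bool) \<Rightarrow> bool" where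
  "borel_reducible M R N S \<longleftrightarrow>
     (\<exists>f \<in> M \<rightarrow>\<^sub>M N. \<forall>x\<in>space M. \<forall>y\<in>space M. R x y \<longleftrightarrow> S (f x) (f y))"

definition strictly_borel_reducible ::
    "'a measure \<Rightarrow> ('a \<Rightarrow> 'a \<Rightarrow> bool) \<Rightarrow> 'b measure \<Rightarrow> ('b \<Rightarrow> 'b \<Rightarrow> bool) \<Rightarrow> bool" where
  "strictly_borel_reducible M R N S \<longleftrightarrow> borel_reducible M R N S \<and> \<not> borel_reducible N S M R"

end

theory Submission
  imports Defs
begin

text \<open>
  Distances are taken in a well-ordered set, so they are bounded away from zero and the spaces are
  countable.  Adding a new largest distance \<open>m\<close> allows one to place the members of a sequence of
  spaces at mutual distance \<open>m\<close>; such sums embed into each other iff some injection of the indices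
  matches every summand with one it embeds into.  Constant sequences give the reduction.

  Suppose conversely that these sums reduce Borel to the relation \<open>R\<close> on the given spaces.  Since \<open>R\<close> has a
  least and a greatest element, nesting the sums embeds the lexicographic product of \<open>\<omega>\<^sup>*\<close> with
  \<open>R\<close>, and hence the countable power of \<open>R\<close>, into \<open>R\<close>.  Therefore the class of relations
  \<open>R (F x) (G y)\<close>, with \<open>F\<close> and \<open>G\<close> Borel, is closed under countable unions and intersections, and
  contains all Borel subsets of a product.  If \<open>R\<close> is Borel, this is refuted by diagonalization: a
  Borel function is given, off a meagre set, by a sequence of open sets, and such a pair of
  sequences can be coded by \<open>x + y\<close>.
\<close>

section \<open>Borel sets not given by Borel rectangles\<close>

definition meagre :: "'a::topological_space set \<Rightarrow> bool" where
  "meagre A \<longleftrightarrow> (\<exists>\<G>. countable \<G> \<and> (\<forall>T\<in>\<G>. closed T \<and> interior T = {}) \<and> A \<subseteq> \<Union>\<G>)"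

lemma meagre_subset: "meagre B \<Longrightarrow> A \<subseteq> B \<Longrightarrow> meagre A"
  unfolding meagre_def by (meson subset_trans)

lemma meagre_closed: "closed T \<Longrightarrow> interior T = {} \<Longrightarrow> meagre T"
  unfolding meagre_def by (intro exI[of _ "{T}"]) auto

lemma meagre_Union_countable:
  assumes "\<And>n::nat. meagre (A n)"
  shows "meagre (\<Union>n. A n)"
proof -
  obtain \<G> where \<G>: "\<And>n. countable (\<G> n) \<and> (\<forall>T\<in>\<G> n. closed T \<and> interior T = {}) \<and> A n \<subseteq> \<Union>(\<G> n)"
    using assms unfolding meagre_def by metis
  have "A n \<subseteq> \<Union>(\<Union>n. \<G> n)" for n
    using \<G>[of n] by (meson UN_upper Union_mono UNIV_I subset_trans)
  then have "(\<Union>n. A n) \<subseteq> \<Union>(\<Union>n. \<G> n)" by (rule UN_least)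
  moreover have "countable (\<Union>n. \<G> n)" using \<G> by simp
  moreover have "\<forall>T\<in>(\<Union>n. \<G> n). closed T \<and> interior T = {}" using \<G> by simp
  ultimately show ?thesis
    unfolding meagre_def by metis
qed

lemma meagre_Un:
  assumes "meagre A" "meagre B"
  shows "meagre (A \<union> B)"
proof -
  have "meagre (\<Union>n::nat. if n = 0 then A else B)"
    using assms by (intro meagre_Union_countable) auto
  then show ?thesis
    by (rule meagre_subset) (auto intro: exI[of _ "0::nat"] exI[of _ "1::nat"])
qed

lemma not_meagre_UNIV: "\<not> meagre (UNIV :: 'a::complete_space set)"
proof
  assume "meagre (UNIV :: 'a set)"
  then obtain \<G> :: "'a set set" where \<G>: "countable \<G>" "\<And>T. T \<in> \<G> \<Longrightarrow> closed T \<and> interior T = {}"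
    "UNIV \<subseteq> \<Union>\<G>"
    unfolding meagre_def by auto
  have "euclidean interior_of \<Union>\<G> = {}"
    using \<G> by (intro Baire_category_alt) (auto simp: completely_metrizable_space_euclidean)
  moreover have "\<Union>\<G> = UNIV" using \<G>(3) by blast
  ultimately show False by simp
qed

text \<open>A continuous involution is a homeomorphism, so it carries closed sets with empty
  interior to such sets. The case of interest is the reflection \<open>x\<close> to
  \<open>c - x\<close> of the sequence space.\<close>

lemma meagre_vimage_involution:
  fixes r :: "'a::topological_space \<Rightarrow> 'a"
  assumes "continuous_on UNIV r" and r: "\<And>x. r (r x) = x" and "meagre A"
  shows "meagre (r -` A)"
proof -
  obtain \<G> where \<G>: "countable \<G>" "\<And>T. T \<in> \<G> \<Longrightarrow> closed T \<and> interior T = {}" "A \<subseteq> \<Union>\<G>"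
    using assms(3) unfolding meagre_def by auto
  have "interior (r -` T) = {}" if "T \<in> \<G>" for T
  proof -
    have "open (r -` interior (r -` T))"
      using assms(1) open_interior by (simp add: open_vimage)
    moreover have "r -` interior (r -` T) \<subseteq> T"
      using interior_subset[of "r -` T"] r by (metis subsetI subsetD vimageE)
    ultimately have "r -` interior (r -` T) = {}"
      using \<G>(2)[OF that] by (metis interior_maximal subset_empty)
    then show ?thesis using r by (metis empty_iff equals0I vimageI)
  qed
  then have "\<forall>T\<in>(-`) r ` \<G>. closed T \<and> interior T = {}"
    using \<G>(2) assms(1) by (auto intro: closed_vimage)
  moreover have "r -` A \<subseteq> \<Union>((-`) r ` \<G>)"
  proof
    fix x assume "x \<in> r -` A"
    then have "r x \<in> \<Union>\<G>" using \<G>(3) by auto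
    then show "x \<in> \<Union>((-`) r ` \<G>)" by auto
  qed
  ultimately show ?thesis
    using \<G>(1) unfolding meagre_def by (intro exI[of _ "(-`) r ` \<G>"] conjI) simp_all
qed

text \<open>Agreement with an open set modulo a meagre set survives countable unions termwise. For
  complements, \<open>- closure U\<close> replaces the closed set \<open>- U\<close>; the two differ
  only on the frontier of \<open>U\<close>, which is nowhere dense.\<close>

lemma borel_Baire_property:
  assumes "A \<in> sets (borel :: 'a::topological_space measure)"
  obtains U where "open U" "meagre (sym_diff A U)"
proof -
  have "A \<in> sigma_sets UNIV {S. open S}"
    using assms by (simp add: borel_def)
  then have "\<exists>U. open U \<and> meagre (sym_diff A U)"
  proof induction
    case (Basic a)
    then show ?case by (intro exI[of _ a]) (auto intro: meagre_closed[of "{}"])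
  next
    case Empty
    show ?case by (intro exI[of _ "{}"]) (auto intro: meagre_closed[of "{}"])
  next
    case (Compl a)
    then obtain U where U: "open U" "meagre (sym_diff a U)" by auto
    \<comment> \<open>An open set that misses \<open>U\<close> misses \<open>closure U\<close> as
      well, but the frontier lies inside \<open>closure U\<close>.\<close>
    have "interior (frontier U) \<inter> U = {}"
      using U(1) interior_subset[of "frontier U"] by (auto simp: frontier_def interior_open)
    then have "interior (frontier U) \<inter> closure U = {}"
      by (simp add: open_Int_closure_eq_empty)
    then have "interior (frontier U) = {}"
      using interior_subset[of "frontier U"] by (auto simp: frontier_def)
    then have "meagre (frontier U)"
      by (intro meagre_closed) auto
    with U(2) have "meagre (sym_diff a U \<union> frontier U)" by (rule meagre_Un)
    then have "meagre (sym_diff (UNIV - a) (- closure U))"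
      by (rule meagre_subset) (use U(1) closure_subset[of U] in \<open>auto simp: frontier_def interior_open\<close>)
    then show ?case by (intro exI[of _ "- closure U"]) auto
  next
    case (Union a)
    then obtain U where U: "\<And>n. open (U n) \<and> meagre (sym_diff (a n) (U n))" by metis
    then have "meagre (\<Union>n. sym_diff (a n) (U n))" by (intro meagre_Union_countable) auto
    then have "meagre (sym_diff (\<Union>n. a n) (\<Union>n. U n))" by (rule meagre_subset) auto
    then show ?case using U by (intro exI[of _ "\<Union>n. U n"]) auto
  qed
  then show thesis using that by auto
qed

section \<open>Codes for measurable sets and open sets\<close>

abbreviation cantor :: "(nat \<Rightarrow> bool) measure" where
  "cantor \<equiv> Pi\<^sub>M UNIV (\<lambda>_. count_space UNIV)"

text \<open>Each set of the product algebra is generated from countably many rectangles. Recording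
  membership in their sides maps both factors to Cantor space, where a single measurable set
  \<open>S'\<close> then decides membership in \<open>S\<close>.\<close>

lemma pair_measure_countably_determined:
  assumes S: "S \<in> sets (M \<Otimes>\<^sub>M N)"
  obtains V W S' where "\<And>n::nat. V n \<in> sets M" "\<And>n. W n \<in> sets N" "S' \<in> sets (cantor \<Otimes>\<^sub>M cantor)"
    "\<And>x y. x \<in> space M \<Longrightarrow> y \<in> space N \<Longrightarrow>
       (x, y) \<in> S \<longleftrightarrow> ((\<lambda>n. x \<in> V n), (\<lambda>n. y \<in> W n)) \<in> S'"
proof -
  define det where "det s V W S' \<longleftrightarrow>
      (\<forall>n::nat. V n \<in> sets M \<and> W n \<in> sets N) \<and> S' \<in> sets (cantor \<Otimes>\<^sub>M cantor) \<and>
      (\<forall>x\<in>space M. \<forall>y\<in>space N. (x, y) \<in> s \<longleftrightarrow> ((\<lambda>n. x \<in> V n), (\<lambda>n. y \<in> W n)) \<in> S')"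
    for s V W S'
  have "S \<in> sigma_sets (space M \<times> space N) {a \<times> b | a b. a \<in> sets M \<and> b \<in> sets N}"
    using S by (simp add: sets_pair_measure)
  then have "\<exists>V W S'. det S V W S'"
  proof induction
    case (Basic s)
    then obtain a b where s: "s = a \<times> b" "a \<in> sets M" "b \<in> sets N" by auto
    have "{p \<in> space (cantor \<Otimes>\<^sub>M cantor). fst p 0 \<and> snd p 0} \<in> sets (cantor \<Otimes>\<^sub>M cantor)"
      by measurable
    with s have "det s (\<lambda>_. a) (\<lambda>_. b) {p \<in> space (cantor \<Otimes>\<^sub>M cantor). fst p 0 \<and> snd p 0}"
      unfolding det_def by (auto simp: space_pair_measure space_PiM)
    then show ?case by blast
  next
    case Empty
    have "det {} (\<lambda>_. {}) (\<lambda>_. {}) {}" unfolding det_def by auto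
    then show ?case by blast
  next
    case (Compl s)
    then obtain V W S' where "det s V W S'" by blast
    then have "det (space M \<times> space N - s) V W (space (cantor \<Otimes>\<^sub>M cantor) - S')"
      using sets.compl_sets[of S' "cantor \<Otimes>\<^sub>M cantor"]
      unfolding det_def by (auto simp: space_pair_measure space_PiM)
    then show ?case by blast
  next
    case (Union s)
    from Union.IH obtain V W S' where *: "\<And>i. det (s i) (V i) (W i) (S' i)" by metis
    \<comment> \<open>The sequences belonging to the sets \<open>s i\<close> are interleaved through
      \<open>prod_encode\<close>; \<open>sl i\<close> recovers the \<open>i\<close>-th row of
      both.\<close>
    define sl where "sl i p = ((\<lambda>n. fst p (prod_encode (i, n))), (\<lambda>n. snd p (prod_encode (i, n))))"
      for i :: nat and p :: "(nat \<Rightarrow> bool) \<times> (nat \<Rightarrow> bool)"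
    have sl: "sl i \<in> cantor \<Otimes>\<^sub>M cantor \<rightarrow>\<^sub>M cantor \<Otimes>\<^sub>M cantor" for i
      unfolding sl_def
      by (intro measurable_Pair measurable_PiM_single' measurable_compose[OF measurable_fst]
            measurable_compose[OF measurable_snd] measurable_component_singleton) (auto simp: space_pair_measure)
    let ?T = "\<Union>i. sl i -` S' i \<inter> space (cantor \<Otimes>\<^sub>M cantor)"
    have "?T \<in> sets (cantor \<Otimes>\<^sub>M cantor)"
      using * measurable_sets[OF sl] unfolding det_def
      by (intro sets.countable_UN) blast
    with * have "det (\<Union>i. s i) (\<lambda>k. V (fst (prod_decode k)) (snd (prod_decode k)))
        (\<lambda>k. W (fst (prod_decode k)) (snd (prod_decode k))) ?T"
      unfolding det_def by (simp add: sl_def space_pair_measure space_PiM)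
    then show ?case by blast
  qed
  then show thesis using that unfolding det_def by blast
qed

text \<open>A universal Borel set for sequences of open sets. Codes are real rather than binary
  sequences so that they form a group in which a code can be split as a sum; the sign of entry
  \<open>(n, j)\<close> decides whether the basic set \<open>B j\<close> is put into the
  \<open>n\<close>-th open set.\<close>

lemma open_set_coding:
  obtains code :: "(nat \<Rightarrow> real) \<Rightarrow> nat \<Rightarrow> 'x::second_countable_topology set" where
    "\<And>U. (\<And>n. open (U n)) \<Longrightarrow> \<exists>c. code c = U"
    "\<And>n. {(c, x). x \<in> code c n} \<in> sets (borel \<Otimes>\<^sub>M borel)"
proof -
  obtain \<B> :: "'x set set" where \<B>: "countable \<B>" "topological_basis \<B>"
    using ex_countable_basis by blast
  define B where "B = from_nat_into (insert {} \<B>)"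
  have rB: "range B = insert {} \<B>"
    unfolding B_def using \<B>(1) by (intro range_from_nat_into) auto
  have B: "open (B j)" for j
    using rB \<B>(2) topological_basis_open by (metis insertE open_empty rangeI)
  define code where "code c n = \<Union>{B j | j. c (prod_encode (n, j)) > 0}" for c :: "nat \<Rightarrow> real" and n
  have "\<exists>c. code c = U" if U: "\<And>n. open (U n)" for U
  proof
    define c :: "nat \<Rightarrow> real" where
      "c k = (if B (snd (prod_decode k)) \<subseteq> U (fst (prod_decode k)) then 1 else 0)" for k
    have "x \<in> code c n" if "x \<in> U n" for x n
    proof -
      obtain V where "V \<in> \<B>" "x \<in> V" "V \<subseteq> U n"
        using \<B>(2) U \<open>x \<in> U n\<close> topological_basisE by metis
      moreover then obtain j where "V = B j" using rB by (metis insertI2 imageE)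
      ultimately show ?thesis unfolding code_def c_def by auto
    qed
    moreover have "code c n \<subseteq> U n" for n
      unfolding code_def c_def by (auto split: if_splits)
    ultimately show "code c = U" by blast
  qed
  moreover have "{(c, x). x \<in> code c n} \<in> sets (borel \<Otimes>\<^sub>M borel)" for n
  proof -
    have "{(c, x). x \<in> code c n} = (\<Union>j. {c. c (prod_encode (n, j)) > 0} \<times> B j)"
      unfolding code_def by auto
    moreover have "{c :: nat \<Rightarrow> real. c (prod_encode (n, j)) > 0} \<in> sets borel" for j
      by measurable
    ultimately show ?thesis
      using B by (auto intro!: sets.countable_UN)
  qed
  ultimately show thesis using that by blast
qed

text \<open>
  The points \<open>x\<close> and \<open>y\<close> jointly code, through their sum, the sequences of open sets which agree
  modulo meagre sets with the preimages that determine \<open>(F x, G y) \<in> S\<close>; by the Baire category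
  theorem any given code is the sum of two points at which this agreement is exact.
\<close>

lemma borel_rectangle_diagonalization:
  fixes M :: "'a measure" and N :: "'b measure"
  assumes S: "S \<in> sets (M \<Otimes>\<^sub>M N)"
  obtains A :: "((nat \<Rightarrow> real) \<times> (nat \<Rightarrow> real)) set" where "A \<in> sets (borel \<Otimes>\<^sub>M borel)"
    "\<And>F G. F \<in> borel \<rightarrow>\<^sub>M M \<Longrightarrow> G \<in> borel \<rightarrow>\<^sub>M N \<Longrightarrow> \<exists>x y. (x, y) \<in> A \<longleftrightarrow> (F x, G y) \<notin> S"
proof -
  obtain V W S' where V: "\<And>n::nat. V n \<in> sets M" and W: "\<And>n. W n \<in> sets N"
    and S': "S' \<in> sets (cantor \<Otimes>\<^sub>M cantor)"
    and S_iff: "\<And>x y. x \<in> space M \<Longrightarrow> y \<in> space N \<Longrightarrow>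
       (x, y) \<in> S \<longleftrightarrow> ((\<lambda>n. x \<in> V n), (\<lambda>n. y \<in> W n)) \<in> S'"
    using pair_measure_countably_determined[OF S] by blast
  obtain code :: "(nat \<Rightarrow> real) \<Rightarrow> nat \<Rightarrow> (nat \<Rightarrow> real) set" where
    code: "\<And>U. (\<And>n. open (U n)) \<Longrightarrow> \<exists>c. code c = U" and
    [measurable]: "\<And>n. {(c, x). x \<in> code c n} \<in> sets (borel \<Otimes>\<^sub>M borel)"
    using open_set_coding by blast
  define s where "s x y = (\<lambda>i. x i + y i)" for x y :: "nat \<Rightarrow> real"
  have s_meas: "(\<lambda>p. s (fst p) (snd p)) \<in> borel \<Otimes>\<^sub>M borel \<rightarrow>\<^sub>M borel"
    unfolding s_def 
    by (intro measurable_coordinatewise_then_product borel_measurable_add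
          measurable_compose[OF measurable_fst measurable_product_coordinates]
          measurable_compose[OF measurable_snd measurable_product_coordinates])
  \<comment> \<open>The code \<open>x + y\<close> is read on both sides: its even entries test the
    first point, its odd entries the second. The diagonal set consists of the pairs that
    \<open>\<Phi>\<close> sends outside \<open>S'\<close>.\<close>
  define \<Phi> where "\<Phi> p = ((\<lambda>n. fst p \<in> code (s (fst p) (snd p)) (2*n)),
      (\<lambda>n. snd p \<in> code (s (fst p) (snd p)) (2*n+1)))" for p
  have m1: "(\<lambda>p. (s (fst p) (snd p), fst p)) \<in> borel \<Otimes>\<^sub>M borel \<rightarrow>\<^sub>M borel \<Otimes>\<^sub>M borel"
    and m2: "(\<lambda>p. (s (fst p) (snd p), snd p)) \<in> borel \<Otimes>\<^sub>M borel \<rightarrow>\<^sub>M borel \<Otimes>\<^sub>M borel"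
    using s_meas by measurable
  have "{p. fst p \<in> code (s (fst p) (snd p)) n} \<in> sets (borel \<Otimes>\<^sub>M borel)"
    "{p. snd p \<in> code (s (fst p) (snd p)) n} \<in> sets (borel \<Otimes>\<^sub>M borel)" for n
    using measurable_sets[OF m1, of "{(c, x). x \<in> code c n}"]
      measurable_sets[OF m2, of "{(c, x). x \<in> code c n}"]
    by (simp_all add: vimage_def space_pair_measure)
  then have "\<Phi> \<in> borel \<Otimes>\<^sub>M borel \<rightarrow>\<^sub>M cantor \<Otimes>\<^sub>M cantor"
    unfolding \<Phi>_def
    by (intro measurable_Pair measurable_PiM_single') (auto simp: space_pair_measure pred_def)
  then have "\<Phi> -` (space (cantor \<Otimes>\<^sub>M cantor) - S') \<inter> space (borel \<Otimes>\<^sub>M borel) \<in> sets (borel \<Otimes>\<^sub>M borel)"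
    by (rule measurable_sets[OF _ sets.compl_sets[OF S']])
  then have A: "{p. \<Phi> p \<notin> S'} \<in> sets (borel \<Otimes>\<^sub>M borel)"
    by (simp add: space_pair_measure space_PiM vimage_def)
  show thesis
  proof (rule that[OF A])
    fix F :: "(nat \<Rightarrow> real) \<Rightarrow> 'a" and G :: "(nat \<Rightarrow> real) \<Rightarrow> 'b"
    assume F: "F \<in> borel \<rightarrow>\<^sub>M M" and G: "G \<in> borel \<rightarrow>\<^sub>M N"
    define P where "P n = (if even n then F -` V (n div 2) else G -` W (n div 2))" for n
    have "P n \<in> sets borel" for n
      unfolding P_def using measurable_sets[OF F V] measurable_sets[OF G W] by simp
    then have "\<exists>U. open U \<and> meagre (sym_diff (P n) U)" for n
      using borel_Baire_property by metis
    then obtain U where U: "\<And>n. open (U n)" "\<And>n. meagre (sym_diff (P n) (U n))" by metis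
    obtain c where c: "code c = U" using code U(1) by blast
    \<comment> \<open>The partner of \<open>x\<close> is forced by \<open>x + r x = c\<close>. Both
      \<open>x\<close> and \<open>r x\<close> must avoid the meagre set \<open>?B\<close>, so its
      reflection is removed too.\<close>
    define r where "r x = (\<lambda>i. c i - x i)" for x
    let ?B = "\<Union>n. sym_diff (P n) (U n)"
    have "meagre ?B" using U(2) by (rule meagre_Union_countable)
    moreover have "continuous_on UNIV r"
      unfolding r_def
      by (intro continuous_on_coordinatewise_then_product continuous_on_diff) auto
    ultimately have "meagre (?B \<union> r -` ?B)"
      by (intro meagre_Un meagre_vimage_involution) (auto simp: r_def)
    then have "?B \<union> r -` ?B \<noteq> UNIV" using not_meagre_UNIV by auto
    moreover have "\<exists>x. x \<notin> B" if "B \<noteq> UNIV" for B :: "(nat \<Rightarrow> real) set"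
      using that by auto
    ultimately obtain x where "x \<notin> ?B \<union> r -` ?B" by presburger
    then have x: "x \<notin> ?B" "r x \<notin> ?B" by simp_all
    have sx: "s x (r x) = c" by (simp add: s_def r_def)
    have "F x \<in> V n \<longleftrightarrow> x \<in> U (2*n)" for n
      using x(1) UN_I[OF UNIV_I, of x "\<lambda>n. sym_diff (P n) (U n)" "2*n"] by (auto simp: P_def)
    moreover have "G (r x) \<in> W n \<longleftrightarrow> r x \<in> U (2*n+1)" for n
      using x(2) UN_I[OF UNIV_I, of "r x" "\<lambda>n. sym_diff (P n) (U n)" "2*n+1"] by (auto simp: P_def)
    ultimately have "\<Phi> (x, r x) = ((\<lambda>n. F x \<in> V n), (\<lambda>n. G (r x) \<in> W n))"
      by (simp add: \<Phi>_def sx c)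
    then show "\<exists>x y. (x, y) \<in> {p. \<Phi> p \<notin> S'} \<longleftrightarrow> (F x, G y) \<notin> S"
      using S_iff measurable_space[OF F] measurable_space[OF G]
      by (intro exI[of _ x] exI[of _ "r x"]) simp
  qed
qed

section \<open>Relations absorbing their injective jump\<close>

text \<open>\<open>J\<close> internalizes comparison of sequences along injections of their indices.
  It will be a hypothetical reduction applied after the formation of sums. Measurability is asked
  for along Borel families over the sequence space, where the diagonalization takes place.\<close>

locale absorbed_injective_jump =
  fixes M :: "'a measure" and R :: "'a \<Rightarrow> 'a \<Rightarrow> bool" and J :: "(nat \<Rightarrow> 'a) \<Rightarrow> 'a" and bot top :: 'a
  assumes refl: "x \<in> space M \<Longrightarrow> R x x"
    and trans: "x \<in> space M \<Longrightarrow> y \<in> space M \<Longrightarrow> z \<in> space M \<Longrightarrow> R x y \<Longrightarrow> R y z \<Longrightarrow> R x z"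
    and bot_in: "bot \<in> space M" and top_in: "top \<in> space M"
    and bot_least: "x \<in> space M \<Longrightarrow> R bot x" and top_greatest: "x \<in> space M \<Longrightarrow> R x top"
    and not_top_bot: "\<not> R top bot"
    and J_in: "(\<And>n. s n \<in> space M) \<Longrightarrow> J s \<in> space M"
    and J_measurable: "\<And>F :: nat \<Rightarrow> (nat \<Rightarrow> real) \<Rightarrow> 'a.
      (\<And>n. F n \<in> borel \<rightarrow>\<^sub>M M) \<Longrightarrow> (\<lambda>x. J (\<lambda>n. F n x)) \<in> borel \<rightarrow>\<^sub>M M"
    and J_iff: "(\<And>n. s n \<in> space M) \<Longrightarrow> (\<And>n. t n \<in> space M) \<Longrightarrow>
      R (J s) (J t) \<longleftrightarrow> (\<exists>f. inj f \<and> (\<forall>n. R (s n) (t (f n))))"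
begin

text \<open>
  \<open>level k u\<close> lies below \<open>level l v\<close> only if \<open>k > l\<close>, or \<open>k = l\<close> and \<open>R u v\<close>.
  The two copies of \<open>top\<close> in \<open>high u\<close> keep it from lying below any \<open>low v\<close>.
\<close>

definition low :: "'a \<Rightarrow> 'a" where
  "low u = J (\<lambda>n. if n = 0 then u else bot)"

definition high :: "'a \<Rightarrow> 'a" where
  "high u = J (\<lambda>n. if n < 2 then top else if n = 2 then u else bot)"

definition level :: "nat \<Rightarrow> 'a \<Rightarrow> 'a" where
  "level k u = (low ^^ k) (high u)"

definition prod_code :: "(nat \<Rightarrow> 'a) \<Rightarrow> 'a" where
  "prod_code u = J (\<lambda>k. level k (u k))"

lemma low_in: "u \<in> space M \<Longrightarrow> low u \<in> space M"
  unfolding low_def by (rule J_in) (simp add: bot_in)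

lemma high_in: "u \<in> space M \<Longrightarrow> high u \<in> space M"
  unfolding high_def by (rule J_in) (simp add: bot_in top_in)

lemma low_funpow_in: "u \<in> space M \<Longrightarrow> (low ^^ k) u \<in> space M"
  by (induction k) (auto intro: low_in)

lemma level_in: "u \<in> space M \<Longrightarrow> level k u \<in> space M"
  unfolding level_def by (intro low_funpow_in high_in)

text \<open>Entry 0 goes either to \<open>v\<close> or to a padding \<open>bot\<close>; in the
  latter case \<open>u\<close> is below \<open>bot\<close>, hence below \<open>v\<close>.\<close>

lemma low_iff:
  assumes u: "u \<in> space M" and v: "v \<in> space M"
  shows "R (low u) (low v) \<longleftrightarrow> R u v"
proof -
  have "R (low u) (low v) \<longleftrightarrow>
      (\<exists>f. inj f \<and> (\<forall>n::nat. R (if n = 0 then u else bot) (if f n = (0::nat) then v else bot)))"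
    unfolding low_def
    by (rule J_iff[of "\<lambda>n. if n = 0 then u else bot" "\<lambda>n. if n = 0 then v else bot"]) (auto simp: u v bot_in)
  also have "\<dots> \<longleftrightarrow> R u v"
  proof
    assume "\<exists>f. inj f \<and> (\<forall>n::nat. R (if n = 0 then u else bot) (if f n = (0::nat) then v else bot))"
    then obtain f where "\<forall>n::nat. R (if n = 0 then u else bot) (if f n = (0::nat) then v else bot)"
      by blast
    then have "R u (if f 0 = (0::nat) then v else bot)" by (metis (full_types))
    then show "R u v"
      using trans[OF u bot_in v _ bot_least[OF v]] by (auto split: if_splits)
  next
    assume "R u v"
    then show "\<exists>f. inj f \<and> (\<forall>n::nat. R (if n = 0 then u else bot) (if f n = (0::nat) then v else bot))"
      by (intro exI[of _ id]) (auto intro: refl bot_in)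
  qed
  finally show ?thesis .
qed

lemma low_funpow_iff:
  "u \<in> space M \<Longrightarrow> v \<in> space M \<Longrightarrow> R ((low ^^ k) u) ((low ^^ k) v) \<longleftrightarrow> R u v"
  by (induction k) (simp_all add: low_iff low_funpow_in)

text \<open>If \<open>top\<close> is below \<open>v\<close>, so is \<open>u\<close>. Otherwise only
  the entries 0 and 1 on the right can receive the two copies of \<open>top\<close>, which fills
  them, and \<open>u\<close> is left with \<open>v\<close> or \<open>bot\<close>.\<close>

lemma high_iff:
  assumes u: "u \<in> space M" and v: "v \<in> space M"
  shows "R (high u) (high v) \<longleftrightarrow> R u v"
proof -
  let ?s = "\<lambda>u n. if n < (2::nat) then top else if n = 2 then u else bot"
  have "R (high u) (high v) \<longleftrightarrow> (\<exists>f. inj f \<and> (\<forall>n. R (?s u n) (?s v (f n))))"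
    unfolding high_def by (rule J_iff[of "?s u" "?s v"]) (auto simp: u v bot_in top_in)
  also have "\<dots> \<longleftrightarrow> R u v"
  proof
    assume "\<exists>f. inj f \<and> (\<forall>n. R (?s u n) (?s v (f n)))"
    then obtain f where f: "inj f" "\<And>n. R (?s u n) (?s v (f n))" by blast
    have f0: "R top (?s v (f 0))" using f(2)[of 0] by simp
    have f1: "R top (?s v (f 1))" using f(2)[of 1] by simp
    have f2: "R u (?s v (f 2))" using f(2)[of 2] by simp
    have ne: "f 0 \<noteq> f 1" "f 2 \<noteq> f 0" "f 2 \<noteq> f 1"
      using injD[OF f(1), of 0 1] injD[OF f(1), of 2 0] injD[OF f(1), of 2 1] by auto
    show "R u v"
    proof (cases "R top v")
      case True
      then show ?thesis using trans[OF u top_in v top_greatest[OF u]] by blast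
    next
      case False
      then have "f 0 < 2" "f 1 < 2" using f0 f1 not_top_bot by (metis (full_types))+
      then have "\<not> f 2 < 2" using ne by linarith
      then show ?thesis
        using f2 trans[OF u bot_in v _ bot_least[OF v]] by (auto split: if_splits)
    qed
  next
    assume "R u v"
    then show "\<exists>f. inj f \<and> (\<forall>n. R (?s u n) (?s v (f n)))"
      by (intro exI[of _ id]) (auto intro: refl bot_in top_in)
  qed
  finally show ?thesis .
qed

lemma not_high_le_low:
  assumes u: "u \<in> space M" and v: "v \<in> space M"
  shows "\<not> R (high u) (low v)"
proof
  let ?s = "\<lambda>n. if n < (2::nat) then top else if n = 2 then u else bot"
  let ?t = "\<lambda>n. if n = (0::nat) then v else bot"
  assume "R (high u) (low v)"
  moreover have "R (high u) (low v) \<longleftrightarrow> (\<exists>f. inj f \<and> (\<forall>n. R (?s n) (?t (f n))))"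
    unfolding low_def high_def by (rule J_iff[of ?s ?t]) (auto simp: u v bot_in top_in)
  ultimately obtain f where f: "inj f" "\<And>n. R (?s n) (?t (f n))" by blast
  have "R top (?t (f 0))" "R top (?t (f 1))" using f(2)[of 0] f(2)[of 1] by simp_all
  then have "f 0 = 0" "f 1 = 0" using not_top_bot by (metis (full_types))+
  then show False using injD[OF f(1), of 0 1] by simp
qed

lemma level_same_iff: "u \<in> space M \<Longrightarrow> v \<in> space M \<Longrightarrow> R (level k u) (level k v) \<longleftrightarrow> R u v"
  unfolding level_def by (simp add: low_funpow_iff high_in high_iff)

text \<open>Cancelling \<open>k\<close> applications of \<open>low\<close> leaves a
  \<open>high\<close> on the left and a \<open>low\<close> on the right.\<close>

lemma not_level_le:
  assumes "u \<in> space M" "v \<in> space M" "k < l"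
  shows "\<not> R (level k u) (level l v)"
proof -
  obtain d where l: "l = k + Suc d" using \<open>k < l\<close> less_iff_Suc_add by auto
  have "level l v = (low ^^ k) (low ((low ^^ d) (high v)))"
    unfolding level_def l funpow_add by (simp only: comp_apply funpow.simps)
  then show ?thesis
    using assms unfolding level_def
    by (simp add: low_funpow_iff high_in low_in low_funpow_in not_high_le_low)
qed

lemma prod_code_in: "(\<And>k. u k \<in> space M) \<Longrightarrow> prod_code u \<in> space M"
  unfolding prod_code_def by (intro J_in level_in)

text \<open>An injection witnessing the left-hand side satisfies \<open>f k \<le> k\<close>, so it is the identity.\<close>

lemma prod_code_iff:
  assumes u: "\<And>k. u k \<in> space M" and v: "\<And>k. v k \<in> space M"
  shows "R (prod_code u) (prod_code v) \<longleftrightarrow> (\<forall>k. R (u k) (v k))"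
proof -
  have "R (prod_code u) (prod_code v) \<longleftrightarrow>
      (\<exists>f. inj f \<and> (\<forall>k. R (level k (u k)) (level (f k) (v (f k)))))"
    unfolding prod_code_def
    by (rule J_iff[of "\<lambda>k. level k (u k)" "\<lambda>k. level k (v k)"]) (auto intro: level_in u v)
  also have "\<dots> \<longleftrightarrow> (\<forall>k. R (u k) (v k))"
  proof
    assume "\<exists>f. inj f \<and> (\<forall>k. R (level k (u k)) (level (f k) (v (f k))))"
    then obtain f where f: "inj f" "\<And>k. R (level k (u k)) (level (f k) (v (f k)))" by blast
    have le: "f k \<le> k" for k
      using f(2)[of k] not_level_le[OF u v] by (meson leI)
    have "f k = k" for k
    proof (induction k rule: less_induct)
      case (less k)
      then show ?case using le[of k] injD[OF f(1), of k "f k"] by (metis order_le_less)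
    qed
    then show "\<forall>k. R (u k) (v k)" using f(2) level_same_iff[OF u v] by metis
  next
    assume "\<forall>k. R (u k) (v k)"
    then show "\<exists>f. inj f \<and> (\<forall>k. R (level k (u k)) (level (f k) (v (f k))))"
      by (intro exI[of _ id]) (auto simp: level_same_iff u v)
  qed
  finally show ?thesis .
qed

text \<open>This turns an existential quantifier over indices into one comparison, as
  \<open>prod_code_iff\<close> does for the universal one.\<close>

lemma low_le_J_iff:
  assumes u: "u \<in> space M" and v: "\<And>n. v n \<in> space M"
  shows "R (low u) (J v) \<longleftrightarrow> (\<exists>n. R u (v n))"
proof -
  let ?s = "\<lambda>n. if n = (0::nat) then u else bot"
  have "R (low u) (J v) \<longleftrightarrow> (\<exists>f. inj f \<and> (\<forall>n. R (?s n) (v (f n))))"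
    unfolding low_def by (rule J_iff[of ?s v]) (auto simp: u v bot_in)
  also have "\<dots> \<longleftrightarrow> (\<exists>n. R u (v n))"
  proof
    assume "\<exists>f. inj f \<and> (\<forall>n. R (?s n) (v (f n)))"
    then obtain f where "\<forall>n. R (?s n) (v (f n))" by blast
    then have "R (?s 0) (v (f 0))" by blast
    then show "\<exists>n. R u (v n)" by auto
  next
    assume "\<exists>n. R u (v n)"
    then obtain m where "R u (v m)" by blast
    then show "\<exists>f. inj f \<and> (\<forall>n. R (?s n) (v (f n)))"
      \<comment> \<open>The shift sends entry 0 to the chosen \<open>m\<close> and distributes the
        copies of \<open>bot\<close> injectively.\<close>
      by (intro exI[of _ "\<lambda>n. m + n"]) (auto intro: bot_least v injI)
  qed
  finally show ?thesis .
qed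

section \<open>Sets defined by comparing two Borel functions\<close>

lemma low_measurable:
  assumes "F \<in> (borel :: (nat \<Rightarrow> real) measure) \<rightarrow>\<^sub>M M"
  shows "(\<lambda>x. low (F x)) \<in> borel \<rightarrow>\<^sub>M M"
proof -
  have "(\<lambda>x. J (\<lambda>n. (if n = 0 then F else (\<lambda>_. bot)) x)) \<in> borel \<rightarrow>\<^sub>M M"
    by (rule J_measurable) (use assms bot_in in auto)
  then show ?thesis unfolding low_def by (simp add: if_distribR)
qed

lemma high_measurable:
  assumes "F \<in> (borel :: (nat \<Rightarrow> real) measure) \<rightarrow>\<^sub>M M"
  shows "(\<lambda>x. high (F x)) \<in> borel \<rightarrow>\<^sub>M M"
proof -
  have "(\<lambda>x. J (\<lambda>n. (if n < 2 then (\<lambda>_. top) else if n = 2 then F else (\<lambda>_. bot)) x)) \<in> borel \<rightarrow>\<^sub>M M"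
    by (rule J_measurable) (use assms bot_in top_in in auto)
  then show ?thesis unfolding high_def by (simp add: if_distribR cong: if_cong)
qed

lemma level_measurable:
  assumes "F \<in> (borel :: (nat \<Rightarrow> real) measure) \<rightarrow>\<^sub>M M"
  shows "(\<lambda>x. level k (F x)) \<in> borel \<rightarrow>\<^sub>M M"
  unfolding level_def by (induction k) (simp_all add: high_measurable assms low_measurable)

lemma prod_code_measurable:
  assumes "\<And>k. F k \<in> (borel :: (nat \<Rightarrow> real) measure) \<rightarrow>\<^sub>M M"
  shows "(\<lambda>x. prod_code (\<lambda>k. F k x)) \<in> borel \<rightarrow>\<^sub>M M"
  unfolding prod_code_def by (intro J_measurable level_measurable assms)

text \<open>The functions on the two coordinates may differ, so \<open>A\<close> need not be a
  quasi-order; this is what makes the class rich enough to contain all Borel sets.\<close>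

definition rectangle_reducible :: "((nat \<Rightarrow> real) \<times> (nat \<Rightarrow> real)) set \<Rightarrow> bool" where
  "rectangle_reducible A \<longleftrightarrow>
     (\<exists>F\<in>borel \<rightarrow>\<^sub>M M. \<exists>G\<in>borel \<rightarrow>\<^sub>M M. \<forall>x y. (x, y) \<in> A \<longleftrightarrow> R (F x) (G y))"

lemma rectangle_reducibleI:
  assumes "F \<in> borel \<rightarrow>\<^sub>M M" "G \<in> borel \<rightarrow>\<^sub>M M" "\<And>x y. (x, y) \<in> A \<longleftrightarrow> R (F x) (G y)"
  shows "rectangle_reducible A"
  using assms unfolding rectangle_reducible_def by blast

lemma rectangle_reducible_choice:
  assumes "\<And>n::nat. rectangle_reducible (A n)"
  obtains F G where "\<And>n. F n \<in> borel \<rightarrow>\<^sub>M M" "\<And>n. G n \<in> borel \<rightarrow>\<^sub>M M"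
    "\<And>n x. F n x \<in> space M" "\<And>n x. G n x \<in> space M"
    "\<And>n x y. (x, y) \<in> A n \<longleftrightarrow> R (F n x) (G n y)"
proof -
  have "\<forall>n. \<exists>F G. F \<in> borel \<rightarrow>\<^sub>M M \<and> G \<in> borel \<rightarrow>\<^sub>M M \<and> (\<forall>x y. (x, y) \<in> A n \<longleftrightarrow> R (F x) (G y))"
    using assms unfolding rectangle_reducible_def by blast
  then obtain F G where FG: "\<And>n. F n \<in> borel \<rightarrow>\<^sub>M M \<and> G n \<in> borel \<rightarrow>\<^sub>M M \<and> (\<forall>x y. (x, y) \<in> A n \<longleftrightarrow> R (F n x) (G n y))"
    by metis
  have "F n x \<in> space M" "G n x \<in> space M" for n x
    using FG[of n] measurable_space[of "F n" borel M x] measurable_space[of "G n" borel M x] by simp_all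
  with FG show thesis by (intro that[of F G]) auto
qed

lemma rectangle_reducible_INT:
  assumes "\<And>n::nat. rectangle_reducible (A n)"
  shows "rectangle_reducible (\<Inter>n. A n)"
proof -
  obtain F G where "\<And>n. F n \<in> borel \<rightarrow>\<^sub>M M" "\<And>n. G n \<in> borel \<rightarrow>\<^sub>M M"
    and "\<And>n x. F n x \<in> space M" "\<And>n x. G n x \<in> space M"
    and "\<And>n x y. (x, y) \<in> A n \<longleftrightarrow> R (F n x) (G n y)"
    by (rule rectangle_reducible_choice[of A, OF assms]) (rule that, assumption+)
  then show ?thesis
    by (intro rectangle_reducibleI[of "\<lambda>x. prod_code (\<lambda>n. F n x)" "\<lambda>x. prod_code (\<lambda>n. G n x)"]
          prod_code_measurable) (simp_all add: prod_code_iff)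
qed

text \<open>In \<open>?G m\<close> every coordinate except \<open>m\<close> is \<open>top\<close>
  and imposes no condition, so comparing the fixed product \<open>?F x\<close> with it tests
  \<open>A m\<close> alone. Then \<open>low\<close> and \<open>J\<close> supply the quantifier over
  \<open>m\<close>.\<close>

lemma rectangle_reducible_UN:
  assumes "\<And>n::nat. rectangle_reducible (A n)"
  shows "rectangle_reducible (\<Union>n. A n)"
proof -
  obtain F G where F: "\<And>n. F n \<in> borel \<rightarrow>\<^sub>M M" and G: "\<And>n. G n \<in> borel \<rightarrow>\<^sub>M M"
    and FG: "\<And>n x. F n x \<in> space M" "\<And>n x. G n x \<in> space M"
    and A: "\<And>n x y. (x, y) \<in> A n \<longleftrightarrow> R (F n x) (G n y)"
    by (rule rectangle_reducible_choice[of A, OF assms]) (rule that, assumption+)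
  let ?F = "\<lambda>x. prod_code (\<lambda>n. F n x)"
  let ?G = "\<lambda>m y. prod_code (\<lambda>n. if n = m then G n y else top)"
  have "(\<lambda>y. prod_code (\<lambda>n. (if n = m then G n else (\<lambda>_. top)) y)) \<in> borel \<rightarrow>\<^sub>M M" for m
    by (rule prod_code_measurable) (use G top_in in auto)
  then have G': "?G m \<in> borel \<rightarrow>\<^sub>M M" for m by (simp add: if_distribR)
  have "R (?F x) (?G m y) \<longleftrightarrow> (x, y) \<in> A m" for x y m
    by (subst prod_code_iff) (auto simp: FG A top_in intro: top_greatest split: if_splits)
  moreover have "?F x \<in> space M" "?G m y \<in> space M" for x y m
    by (auto intro!: prod_code_in simp: FG top_in)
  ultimately have "(x, y) \<in> (\<Union>n. A n) \<longleftrightarrow> R (low (?F x)) (J (\<lambda>m. ?G m y))" for x y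
    by (simp add: low_le_J_iff)
  moreover have "(\<lambda>x. low (?F x)) \<in> borel \<rightarrow>\<^sub>M M"
    by (intro low_measurable prod_code_measurable F)
  moreover have "(\<lambda>y. J (\<lambda>m. ?G m y)) \<in> borel \<rightarrow>\<^sub>M M"
    by (intro J_measurable G')
  ultimately show ?thesis
    by (intro rectangle_reducibleI[of "\<lambda>x. low (?F x)" "\<lambda>y. J (\<lambda>m. ?G m y)"])
qed

lemma rectangle_reducible_cylinders:
  assumes U: "U \<in> sets borel"
  shows "rectangle_reducible (U \<times> UNIV)" "rectangle_reducible (UNIV \<times> U)"
proof -
  have "(\<lambda>x. if x \<in> U then bot else top) \<in> borel \<rightarrow>\<^sub>M M" "(\<lambda>x. if x \<in> U then top else bot) \<in> borel \<rightarrow>\<^sub>M M"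
    using U bot_in top_in by (auto intro!: measurable_If_set)
  moreover have "(x, y) \<in> U \<times> UNIV \<longleftrightarrow> R (if x \<in> U then bot else top) bot"
    "(x, y) \<in> UNIV \<times> U \<longleftrightarrow> R top (if y \<in> U then top else bot)" for x y
    using refl[OF bot_in] refl[OF top_in] not_top_bot by auto
  moreover have "(\<lambda>_. bot) \<in> borel \<rightarrow>\<^sub>M M" "(\<lambda>_. top) \<in> borel \<rightarrow>\<^sub>M M"
    using bot_in top_in by auto
  ultimately show "rectangle_reducible (U \<times> UNIV)" "rectangle_reducible (UNIV \<times> U)"
    by (auto intro: rectangle_reducibleI[of "\<lambda>x. if x \<in> U then bot else top" "\<lambda>_. bot"]
        rectangle_reducibleI[of "\<lambda>_. top" "\<lambda>x. if x \<in> U then top else bot"])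
qed

text \<open>Negation is not expressible through \<open>R\<close> directly, so the induction carries
  each set together with its complement; De Morgan's laws exchange unions and intersections.\<close>

lemma rectangle_reducible_borel:
  assumes "A \<in> sets (borel \<Otimes>\<^sub>M borel)"
  shows "rectangle_reducible A"
proof -
  have Un: "rectangle_reducible (A \<union> B)" if "rectangle_reducible A" "rectangle_reducible B" for A B
  proof -
    have "rectangle_reducible (\<Union>n::nat. if n = 0 then A else B)"
      by (rule rectangle_reducible_UN) (use that in auto)
    moreover have "(\<Union>n::nat. if n = 0 then A else B) = A \<union> B" by auto
    ultimately show ?thesis by simp
  qed
  have Int: "rectangle_reducible (A \<inter> B)" if "rectangle_reducible A" "rectangle_reducible B" for A B
  proof -
    have "rectangle_reducible (\<Inter>n::nat. if n = 0 then A else B)"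
      by (rule rectangle_reducible_INT) (use that in auto)
    moreover have "(\<Inter>n::nat. if n = 0 then A else B) = A \<inter> B" by auto
    ultimately show ?thesis by simp
  qed
  have "A \<in> sigma_sets UNIV {a \<times> b | a b. a \<in> sets borel \<and> b \<in> sets borel}"
    using assms by (simp add: sets_pair_measure)
  then have "rectangle_reducible A \<and> rectangle_reducible (- A)"
  proof induction
    case (Basic s)
    then obtain a b where s: "s = a \<times> b" "a \<in> sets borel" "b \<in> sets borel" by auto
    have "s = a \<times> UNIV \<inter> UNIV \<times> b" "- s = (- a) \<times> UNIV \<union> UNIV \<times> (- b)"
      using s(1) by auto
    moreover have "- a \<in> sets borel" "- b \<in> sets borel"
      using s by auto
    ultimately show ?case
      using s by (metis Int Un rectangle_reducible_cylinders)
  next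
    case Empty
    then show ?case
      using rectangle_reducible_cylinders(1)[of "{}"] rectangle_reducible_cylinders(1)[of UNIV] by simp
  next
    case (Compl a)
    then show ?case by (simp flip: Compl_eq_Diff_UNIV)
  next
    case (Union a)
    then show ?case by (simp add: rectangle_reducible_UN rectangle_reducible_INT)
  qed
  then show ?thesis by simp
qed

text \<open>If \<open>R\<close> were Borel, it could serve as the set \<open>S\<close> of the
  diagonalization, and the resulting Borel set \<open>A\<close> would still be of the form
  \<open>R (F x) (G y)\<close>.\<close>

theorem not_borel_relation: "\<not> borel_relation M R"
proof
  assume "borel_relation M R"
  then have "{(x, y). x \<in> space M \<and> y \<in> space M \<and> R x y} \<in> sets (M \<Otimes>\<^sub>M M)"
    by (simp add: borel_relation_def)
  then obtain A :: "((nat \<Rightarrow> real) \<times> (nat \<Rightarrow> real)) set" where A: "A \<in> sets (borel \<Otimes>\<^sub>M borel)"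
    and diag: "\<And>F G. F \<in> borel \<rightarrow>\<^sub>M M \<Longrightarrow> G \<in> borel \<rightarrow>\<^sub>M M \<Longrightarrow>
      \<exists>x y. (x, y) \<in> A \<longleftrightarrow> (F x, G y) \<notin> {(x, y). x \<in> space M \<and> y \<in> space M \<and> R x y}"
    by (rule borel_rectangle_diagonalization) blast
  obtain F G where F: "F \<in> borel \<rightarrow>\<^sub>M M" and G: "G \<in> borel \<rightarrow>\<^sub>M M"
    and FG: "\<And>x y. (x, y) \<in> A \<longleftrightarrow> R (F x) (G y)"
    using rectangle_reducible_borel[OF A] unfolding rectangle_reducible_def by blast
  then show False
    using diag[OF F G] measurable_space[OF F] measurable_space[OF G] by simp
qed

end

section \<open>Measurable realization in the Urysohn space\<close>

text \<open>By well-foundedness the nonzero distances, if there are any, have a least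
  element.\<close>

lemma distance_set_gap:
  assumes "distance_set r D"
  obtains \<epsilon> where "0 < \<epsilon>" "\<And>d. d \<in> D \<Longrightarrow> d \<noteq> 0 \<Longrightarrow> \<epsilon> \<le> d"
proof (cases "D \<subseteq> {0}")
  case True
  then show thesis using that[of 1] by auto
next
  case False
  then obtain d where d: "d \<in> D - {0}" by auto
  let ?r = "{(x, y). x \<in> D \<and> y \<in> D \<and> x \<le> y}"
  have "Well_order ?r"
    using assms unfolding distance_set_def ordIso_def by blast
  then have "wf (?r - Id)" by (simp add: order_on_defs)
  then obtain z where z: "z \<in> D - {0}" "\<And>y. (y, z) \<in> ?r - Id \<Longrightarrow> y \<notin> D - {0}"
    using d by (rule wfE_min) auto
  have "0 < z" using z(1) assms unfolding distance_set_def by force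
  moreover have "z \<le> d" if "d \<in> D" "d \<noteq> 0" for d
    using z(2)[of d] that z(1) by force
  ultimately show thesis by (rule that)
qed

text \<open>The order isomorphisms identify \<open>D\<close> with the part of \<open>E\<close> below
  the image \<open>m\<close> of \<open>None\<close>.\<close>

lemma distance_set_succ:
  assumes D: "distance_set \<alpha> D" and E: "distance_set (ord_succ \<alpha>) E"
  obtains \<phi> m where "\<phi> ` D \<subseteq> E" "m \<in> E" "\<phi> 0 = 0" "strict_mono_on D \<phi>" "\<And>d. d \<in> D \<Longrightarrow> \<phi> d < m"
proof -
  let ?D = "{(x, y). x \<in> D \<and> y \<in> D \<and> x \<le> y}" and ?E = "{(x, y). x \<in> E \<and> y \<in> E \<and> x \<le> y}"
  have FD: "Field ?D = D" and FE: "Field ?E = E" by (auto simp: Field_def)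
  obtain a where "iso ?D \<alpha> a"
    using D unfolding distance_set_def ordIso_def by auto
  then have a: "bij_betw a D (Field \<alpha>)" "\<And>x y. x \<in> D \<Longrightarrow> y \<in> D \<Longrightarrow> (a x, a y) \<in> \<alpha> \<longleftrightarrow> x \<le> y"
    unfolding iso_iff2 FD by auto
  have "(ord_succ \<alpha>, ?E) \<in> ordIso"
    using E unfolding distance_set_def by (auto intro: ordIso_symmetric)
  then obtain b where "iso (ord_succ \<alpha>) ?E b"
    unfolding ordIso_def by auto
  then have b: "bij_betw b (insert None (Some ` Field \<alpha>)) E"
    "\<And>o1 o2. o1 \<in> insert None (Some ` Field \<alpha>) \<Longrightarrow> o2 \<in> insert None (Some ` Field \<alpha>) \<Longrightarrow>
       (o1, o2) \<in> ord_succ \<alpha> \<longleftrightarrow> b o1 \<in> E \<and> b o2 \<in> E \<and> b o1 \<le> b o2"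
    unfolding iso_iff2 FE Field_ord_succ by auto
  have aF: "a x \<in> Field \<alpha>" if "x \<in> D" for x using a(1) that by (auto simp: bij_betw_def)
  have bE: "b p \<in> E" if "p \<in> insert None (Some ` Field \<alpha>)" for p
    using b(1) that by (auto simp: bij_betw_def)
  define \<phi> where "\<phi> x = b (Some (a x))" for x
  have \<phi>E: "\<phi> x \<in> E" if "x \<in> D" for x unfolding \<phi>_def using aF[OF that] by (intro bE) auto
  have le: "\<phi> x \<le> \<phi> y \<longleftrightarrow> x \<le> y" if "x \<in> D" "y \<in> D" for x y
  proof -
    have "\<phi> x \<le> \<phi> y \<longleftrightarrow> (Some (a x), Some (a y)) \<in> ord_succ \<alpha>"
      using b(2)[of "Some (a x)" "Some (a y)"] aF that \<phi>E unfolding \<phi>_def by auto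
    also have "\<dots> \<longleftrightarrow> x \<le> y"
      using a(2)[OF that] by (auto simp: ord_succ_def)
    finally show ?thesis .
  qed
  have lt: "\<phi> x < b None" if "x \<in> D" for x
  proof -
    have "\<not> b None \<le> \<phi> x"
      using b(2)[of None "Some (a x)"] aF[OF that] bE \<phi>E[OF that]
      unfolding \<phi>_def by (auto simp: ord_succ_def)
    then show ?thesis by simp
  qed
  have zero: "0 \<in> D" "0 \<in> E" "D \<subseteq> {0..}" "E \<subseteq> {0..}"
    using D E unfolding distance_set_def by auto
  \<comment> \<open>Since 0 is least in \<open>D\<close>, its image lies below every
    \<open>b p\<close>; applying this to the \<open>p\<close> with \<open>b p = 0\<close> bounds it
    by 0.\<close>
  have "\<phi> 0 \<le> 0"
  proof -
    obtain p where p: "p \<in> insert None (Some ` Field \<alpha>)" "b p = 0"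
      using b(1) zero(2) by (metis bij_betw_imp_surj_on imageE)
    show ?thesis
    proof (cases p)
      case None
      then show ?thesis using lt[OF zero(1)] p by simp
    next
      case (Some c)
      then have "c \<in> Field \<alpha>" using p by auto
      then obtain y where "y \<in> D" "c = a y" using a(1) by (metis bij_betw_imp_surj_on imageE)
      then show ?thesis using le[of 0 y] zero p Some unfolding \<phi>_def by auto
    qed
  qed
  moreover have "\<phi> 0 \<ge> 0" using \<phi>E zero by auto
  moreover have "strict_mono_on D \<phi>"
    using le by (auto simp: strict_mono_on_def) (meson linorder_not_less)
  ultimately show thesis
    using that[of \<phi> "b None"] \<phi>E bE lt by auto
qed

section \<open>Realizing countable ultrametrics in the Urysohn space\<close>

text \<open>Distinct indices may have distance 0, so that finite spaces too are enumerated by all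
  natural numbers.\<close>

definition pseudo_ultrametric :: "real set \<Rightarrow> (nat \<Rightarrow> nat \<Rightarrow> real) \<Rightarrow> bool" where
  "pseudo_ultrametric D \<delta> \<longleftrightarrow> (\<forall>i. \<delta> i i = 0) \<and> (\<forall>i j. \<delta> i j = \<delta> j i) \<and> (\<forall>i j. \<delta> i j \<in> D) \<and>
     (\<forall>i j k. \<delta> i k \<le> max (\<delta> i j) (\<delta> j k))"

lemma separable_space_countable: "countable (topspace X) \<Longrightarrow> separable_space X"
  unfolding separable_space_def by (intro exI[of _ "topspace X"]) auto

text \<open>Universality applies to metric spaces of reals, so indices at distance 0 are identified
  by passing to their least representative \<open>rep\<close>, which is then viewed as a real. The
  floor in \<open>?d\<close> reads the index back.\<close>

lemma urysohn_space_universal: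
  assumes U: "urysohn_space TYPE('u::polish_space)" and \<delta>: "pseudo_ultrametric D \<delta>" "D \<subseteq> {0..}"
  obtains f :: "nat \<Rightarrow> 'u::polish_space" where "\<And>i j. dist (f i) (f j) = \<delta> i j"
proof -
  have z: "\<delta> i i = 0" and sym: "\<delta> i j = \<delta> j i"
    and ultra: "\<delta> i k \<le> max (\<delta> i j) (\<delta> j k)" and "\<delta> i j \<in> D" for i j k
    using \<delta>(1) unfolding pseudo_ultrametric_def by auto
  then have nn: "0 \<le> \<delta> i j" for i j using \<delta>(2) by (meson atLeast_iff subsetD)
  have eq: "\<delta> i k = \<delta> j k" if "\<delta> i j = 0" for i j k
    using ultra[of i k j] ultra[of j k i] sym[of i j] that nn[of i k] nn[of j k] by simp
  define rep where "rep i = (LEAST j. \<delta> j i = 0)" for i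
  have rep: "\<delta> (rep i) i = 0" for i
    unfolding rep_def by (rule LeastI[of _ i]) (rule z)
  have rep_eq: "rep i = rep j" if "\<delta> i j = 0" for i j
  proof -
    have "\<delta> k i = \<delta> k j" for k using eq[OF that, of k] sym by metis
    then show ?thesis unfolding rep_def by simp
  qed
  have \<delta>_rep: "\<delta> (rep i) (rep j) = \<delta> i j" for i j
    using eq[OF rep[of i], of "rep j"] eq[OF rep[of j], of i] sym by metis
  let ?M = "(\<lambda>i. real (rep i)) ` UNIV" and ?d = "\<lambda>x y. \<delta> (nat \<lfloor>x\<rfloor>) (nat \<lfloor>y\<rfloor>)"
  have "Metric_space ?M ?d"
  proof
    fix x y assume "x \<in> ?M" "y \<in> ?M"
    then obtain i j where "x = real (rep i)" "y = real (rep j)" by auto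
    moreover have "\<delta> i j = 0 \<longleftrightarrow> rep i = rep j" using rep_eq \<delta>_rep z by metis
    ultimately show "?d x y = 0 \<longleftrightarrow> x = y" by (simp add: \<delta>_rep)
  next
    fix x y z
    show "?d x z \<le> ?d x y + ?d y z"
      using ultra[of "nat \<lfloor>x\<rfloor>" "nat \<lfloor>z\<rfloor>" "nat \<lfloor>y\<rfloor>"] nn[of "nat \<lfloor>x\<rfloor>" "nat \<lfloor>y\<rfloor>"] nn[of "nat \<lfloor>y\<rfloor>" "nat \<lfloor>z\<rfloor>"]
      by linarith
  qed (auto simp: nn intro: sym)
  moreover from this have "separable_space (Metric_space.mtopology ?M ?d)"
    by (intro separable_space_countable) (simp add: Metric_space.topspace_mtopology)
  ultimately have "\<exists>f :: real \<Rightarrow> 'u. \<forall>x\<in>?M. \<forall>y\<in>?M. dist (f x) (f y) = ?d x y"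
    by (intro mp[OF U[unfolded urysohn_space_def, THEN conjunct1, THEN spec, THEN spec]] conjI)
  then obtain f :: "real \<Rightarrow> 'u" where "\<forall>x\<in>?M. \<forall>y\<in>?M. dist (f x) (f y) = ?d x y" ..
  then have "dist (f (real (rep i))) (f (real (rep j))) = \<delta> i j" for i j
    using \<delta>_rep by simp
  then show thesis by (rule that)
qed

text \<open>Realize all of \<open>\<delta>\<close> somewhere by universality, move the copy of the
  first \<open>n\<close> points onto \<open>p\<close> by ultrahomogeneity, and take the image of the
  next point.\<close>

lemma urysohn_space_extension:
  assumes U: "urysohn_space TYPE('u::polish_space)" and \<delta>: "pseudo_ultrametric D \<delta>" "D \<subseteq> {0..}"
    and p: "\<And>i j. i < n \<Longrightarrow> j < n \<Longrightarrow> dist (p i) (p j :: 'u::polish_space) = \<delta> i j"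
  shows "\<exists>q. \<forall>i<n. dist (p i) q = \<delta> i n"
proof -
  obtain f :: "nat \<Rightarrow> 'u" where f: "\<And>i j. dist (f i) (f j) = \<delta> i j"
    using urysohn_space_universal[OF U \<delta>] by blast
  \<comment> \<open>Indices with the same \<open>f i\<close> have distance 0 under
    \<open>\<delta>\<close>, hence the same \<open>p i\<close>, so the choice of index is
    immaterial.\<close>
  define g where "g x = p (SOME i. i < n \<and> f i = x)" for x
  have g: "g (f i) = p i" if "i < n" for i
  proof -
    have *: "(SOME j. j < n \<and> f j = f i) < n \<and> f (SOME j. j < n \<and> f j = f i) = f i"
      by (rule someI[of _ i]) (simp add: that)
    then have "dist (p (SOME j. j < n \<and> f j = f i)) (p i) = dist (f i) (f i)"
      using p that f by metis
    then show ?thesis unfolding g_def by simp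
  qed
  have "finite (f ` {..<n})" "\<forall>x\<in>f ` {..<n}. \<forall>y\<in>f ` {..<n}. dist (g x) (g y) = dist x y"
    using g p f by auto
  then have "\<exists>h. surj h \<and> (\<forall>x y. dist (h x) (h y) = dist x y) \<and> (\<forall>x\<in>f ` {..<n}. h x = g x)"
    by (intro mp[OF U[unfolded urysohn_space_def, THEN conjunct2, THEN spec, THEN spec]] conjI)
  then obtain h where h: "\<And>x y. dist (h x) (h y) = dist x y" "\<And>x. x \<in> f ` {..<n} \<Longrightarrow> h x = g x"
    by metis
  have "dist (p i) (h (f n)) = \<delta> i n" if "i < n" for i
    using h(1)[of "f i" "f n"] h(2)[of "f i"] g[OF that] f that by simp
  then show ?thesis by blast
qed

text \<open>
  The points are chosen one at a time so that the first \<open>n\<close> of them depend only on finitely many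
  entries of \<open>\<delta>\<close>; when these range over a countable set, the choice is automatically measurable.
\<close>

primrec points :: "(nat \<Rightarrow> nat \<Rightarrow> real) \<Rightarrow> nat \<Rightarrow> 'u::metric_space list" where
  "points \<delta> 0 = []"
| "points \<delta> (Suc n) = points \<delta> n @ [SOME q. \<forall>i<n. dist (points \<delta> n ! i) q = \<delta> i n]"

definition point :: "(nat \<Rightarrow> nat \<Rightarrow> real) \<Rightarrow> nat \<Rightarrow> 'u::metric_space" where
  "point \<delta> n = points \<delta> (Suc n) ! n"

lemma length_points [simp]: "length (points \<delta> n) = n"
  by (induction n) auto

lemma points_nth: "i < n \<Longrightarrow> points \<delta> n ! i = point \<delta> i"
proof (induction n)
  case (Suc n)
  then show ?case by (cases "i = n") (auto simp: point_def nth_append)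
qed simp

lemma points_cong:
  "(\<And>i j. i < j \<Longrightarrow> j < n \<Longrightarrow> \<delta> i j = \<delta>' i j) \<Longrightarrow> (points \<delta> n :: 'u::metric_space list) = points \<delta>' n"
proof (induction n)
  case (Suc n)
  then have "(points \<delta> n :: 'u list) = points \<delta>' n" by simp
  moreover have "(\<forall>i<n. dist (points \<delta>' n ! i) q = \<delta> i n) \<longleftrightarrow> (\<forall>i<n. dist (points \<delta>' n ! i) q = \<delta>' i n)" for q :: 'u
    using Suc.prems by simp
  ultimately show ?case by simp
qed simp

lemma dist_point:
  assumes U: "urysohn_space TYPE('u::polish_space)" and \<delta>: "pseudo_ultrametric D \<delta>" "D \<subseteq> {0..}"
  shows "dist (point \<delta> i :: 'u::polish_space) (point \<delta> j) = \<delta> i j"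
proof -
  have sym: "\<delta> i j = \<delta> j i" and z: "\<delta> i i = 0" for i j
    using \<delta> unfolding pseudo_ultrametric_def by auto
  have "\<forall>i<n. \<forall>j<n. dist (point \<delta> i :: 'u) (point \<delta> j) = \<delta> i j" for n
  proof (induction n)
    case (Suc n)
    have "\<exists>q. \<forall>i<n. dist (point \<delta> i :: 'u) q = \<delta> i n"
      using Suc.IH by (intro urysohn_space_extension[OF U \<delta>]) auto
    then have "\<forall>i<n. dist (point \<delta> i :: 'u) (SOME q. \<forall>i<n. dist (point \<delta> i) q = \<delta> i n) = \<delta> i n"
      by (rule someI_ex)
    moreover have "point \<delta> n = (SOME q. \<forall>i<n. dist (point \<delta> i :: 'u) q = \<delta> i n)"
      unfolding point_def[of \<delta> n] by (simp add: nth_append points_nth)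
    ultimately have "\<forall>i<n. dist (point \<delta> i :: 'u) (point \<delta> n) = \<delta> i n" by simp
    then show ?case
      using Suc.IH sym z by (auto simp: less_Suc_eq dist_commute)
  qed simp
  then show ?thesis by (meson less_Suc_eq max.strict_coboundedI1 max.strict_coboundedI2 lessI)
qed

definition realization :: "(nat \<Rightarrow> nat \<Rightarrow> real) \<Rightarrow> 'u::metric_space set" where
  "realization \<delta> = range (point \<delta>)"

section \<open>Measurability for the Effros structure\<close>

lemma space_ultra_space:
  "space (ultra_space D :: 'u::metric_space set measure) =
     {X. closed X \<and> X \<noteq> {} \<and> ultrametric_on X \<and> (\<forall>x\<in>X. \<forall>y\<in>X. dist x y \<in> D)}"
  unfolding ultra_space_def effros_def by (auto simp: space_restrict_space space_measure_of_conv)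

lemma pred_ultra_space_hit:
  assumes "open V"
  shows "Measurable.pred (ultra_space D) (\<lambda>X. X \<inter> V \<noteq> {})"
proof -
  have "{F. closed F \<and> F \<inter> V \<noteq> {}} \<in> sets effros"
    unfolding effros_def using assms by (subst sets_measure_of) (auto intro!: sigma_sets.Basic)
  then have "space (ultra_space D) \<inter> {F. closed F \<and> F \<inter> V \<noteq> {}} \<in> sets (ultra_space D)"
    unfolding ultra_space_def sets_restrict_space space_restrict_space effros_def
    by (auto simp: space_measure_of_conv)
  moreover have "space (ultra_space D) \<inter> {F. closed F \<and> F \<inter> V \<noteq> {}} = {X \<in> space (ultra_space D). X \<inter> V \<noteq> {}}"
    by (auto simp: space_ultra_space)
  ultimately show ?thesis by (simp add: pred_def)
qed

lemma measurable_ultra_space: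
  assumes "\<And>x. x \<in> space N \<Longrightarrow> f x \<in> space (ultra_space D)"
    and "\<And>V. open V \<Longrightarrow> {x \<in> space N. f x \<inter> V \<noteq> {}} \<in> sets N"
  shows "f \<in> N \<rightarrow>\<^sub>M ultra_space D"
  unfolding ultra_space_def
proof (rule measurable_restrict_space2)
  show "f \<in> space N \<rightarrow> {X. closed X \<and> X \<noteq> {} \<and> ultrametric_on X \<and> (\<forall>x\<in>X. \<forall>y\<in>X. dist x y \<in> D)}"
    using assms(1) by (auto simp: space_ultra_space)
  show "f \<in> N \<rightarrow>\<^sub>M effros"
    unfolding effros_def
  proof (rule measurable_measure_of)
    show "f \<in> space N \<rightarrow> {F. closed F}"
      using assms(1) by (auto simp: space_ultra_space)
    fix S assume "S \<in> {{F :: 'b set. closed F \<and> F \<inter> V \<noteq> {}} | V. open V}"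
    then obtain V where V: "S = {F. closed F \<and> F \<inter> V \<noteq> {}}" "open V" by auto
    have "f -` S \<inter> space N = {x \<in> space N. f x \<inter> V \<noteq> {}}"
      using assms(1) V by (auto simp: space_ultra_space)
    then show "f -` S \<inter> space N \<in> sets N" using assms(2) V by simp
  qed auto
qed

text \<open>The range is closed because distinct points are at least \<open>\<epsilon>\<close>
  apart.\<close>

lemma realization_in_ultra_space:
  assumes U: "urysohn_space TYPE('u::polish_space)" and "distance_set r D"
    and \<delta>: "pseudo_ultrametric D \<delta>"
  shows "(realization \<delta> :: 'u::polish_space set) \<in> space (ultra_space D)"
proof -
  have D: "D \<subseteq> {0..}" using assms(2) by (simp add: distance_set_def)
  obtain \<epsilon> where \<epsilon>: "0 < \<epsilon>" "\<And>d. d \<in> D \<Longrightarrow> d \<noteq> 0 \<Longrightarrow> \<epsilon> \<le> d"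
    using distance_set_gap[OF assms(2)] by blast
  note dp = dist_point[OF U \<delta> D]
  have in_D: "\<forall>x\<in>realization \<delta> :: 'u set. \<forall>y\<in>realization \<delta>. dist x y \<in> D"
    using \<delta> by (auto simp: realization_def dp pseudo_ultrametric_def)
  have "closed (realization \<delta> :: 'u set)"
  proof (rule discrete_imp_closed[OF \<epsilon>(1)])
    show "\<forall>x\<in>realization \<delta> :: 'u set. \<forall>y\<in>realization \<delta>. dist y x < \<epsilon> \<longrightarrow> y = x"
      using \<epsilon>(2) in_D by (metis dist_eq_0_iff not_le)
  qed
  moreover have "ultrametric_on (realization \<delta> :: 'u set)"
    using \<delta> by (auto simp: ultrametric_on_def realization_def dp pseudo_ultrametric_def)
  ultimately show ?thesis
    using in_D by (auto simp: space_ultra_space) (auto simp: realization_def)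
qed

lemma point_measurable:
  fixes P :: "'u::metric_space \<Rightarrow> bool"
  assumes "countable D" "\<And>x i j. x \<in> space N \<Longrightarrow> \<delta> x i j \<in> D"
    and meas: "\<And>i j d. {x \<in> space N. \<delta> x i j = d} \<in> sets N"
  shows "{x \<in> space N. P (point (\<delta> x) n)} \<in> sets N"
proof -
  let ?I = "{..n} \<times> {..n}"
  \<comment> \<open>\<open>w\<close> runs through the countably many possible distance tables on the
    indices up to \<open>n\<close>. The table determines the point, so the event is a countable
    union of measurable ones for an arbitrary predicate \<open>P\<close>.\<close>
  let ?W = "{w \<in> ?I \<rightarrow>\<^sub>E D. P (point (curry w) n)}"
  let ?S = "\<lambda>w. {x \<in> space N. \<forall>p\<in>?I. \<delta> x (fst p) (snd p) = w p}"
  have pt: "(point (\<delta> x) n :: 'u) = point (curry w) n" if "x \<in> ?S w" for x w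
    unfolding point_def using that by (intro arg_cong2[where f = nth] points_cong) auto
  have "x \<in> (\<Union>w\<in>?W. ?S w)" if "x \<in> space N" "P (point (\<delta> x) n)" for x
  proof -
    let ?w = "restrict (\<lambda>p. \<delta> x (fst p) (snd p)) ?I"
    have x: "x \<in> ?S ?w" using that by auto
    moreover have "P (point (curry ?w) n)" using that(2) by (simp only: pt[OF x])
    then have "?w \<in> ?W" using assms(2) that(1) by auto
    ultimately show ?thesis by blast
  qed
  moreover have "x \<in> space N \<and> P (point (\<delta> x) n)" if "w \<in> ?W" "x \<in> ?S w" for w x
    using pt[OF that(2)] that by simp
  ultimately have "{x \<in> space N. P (point (\<delta> x) n)} = (\<Union>w\<in>?W. ?S w)"
    by (intro set_eqI) (metis (mono_tags, lifting) UN_E mem_Collect_eq)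
  moreover have "countable ?W"
    using assms(1) by (intro countable_Collect countable_PiE) auto
  moreover have "?S w \<in> sets N" for w
    by (intro sets.sets_Collect_finite_All meas) auto
  ultimately show ?thesis by (auto intro!: sets.countable_UN')
qed

lemma realization_measurable:
  assumes U: "urysohn_space TYPE('u::polish_space)" and D: "distance_set r D"
    and \<delta>: "\<And>x. x \<in> space N \<Longrightarrow> pseudo_ultrametric D (\<delta> x)"
    and meas: "\<And>i j d. {x \<in> space N. \<delta> x i j = d} \<in> sets N"
  shows "(\<lambda>x. realization (\<delta> x) :: 'u::polish_space set) \<in> N \<rightarrow>\<^sub>M ultra_space D"
proof (rule measurable_ultra_space)
  fix x assume "x \<in> space N"
  then show "(realization (\<delta> x) :: 'u set) \<in> space (ultra_space D)"
    by (intro realization_in_ultra_space[OF U D] \<delta>)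
next
  fix V :: "'u set"
  have "{x \<in> space N. realization (\<delta> x) \<inter> V \<noteq> {}} = (\<Union>n. {x \<in> space N. point (\<delta> x) n \<in> V})"
    by (auto simp: realization_def)
  moreover have "{x \<in> space N. point (\<delta> x) n \<in> V} \<in> sets N" for n
    using D \<delta> meas by (intro point_measurable[of D]) (auto simp: distance_set_def pseudo_ultrametric_def)
  ultimately show "{x \<in> space N. realization (\<delta> x) \<inter> V \<noteq> {}} \<in> sets N" by auto
qed

text \<open>A basic open set of diameter below the gap \<open>\<epsilon>\<close> meets a space in at
  most one point. Listing the basic sets of this kind therefore lists the points, without any
  genuine selection.\<close>

lemma ultra_space_enumeration:
  assumes "distance_set r D"
  obtains e :: "'u::polish_space set \<Rightarrow> nat \<Rightarrow> 'u" where
    "\<And>X. X \<in> space (ultra_space D) \<Longrightarrow> range (e X) = X"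
    "\<And>n. (\<lambda>X. e X n) \<in> borel_measurable (ultra_space D)"
proof -
  obtain \<epsilon> where \<epsilon>: "0 < \<epsilon>" "\<And>d. d \<in> D \<Longrightarrow> d \<noteq> 0 \<Longrightarrow> \<epsilon> \<le> d"
    using distance_set_gap[OF assms] by blast
  obtain \<B> :: "'u set set" where \<B>: "countable \<B>" "topological_basis \<B>"
    using ex_countable_basis by blast
  define \<B>' where "\<B>' = {B \<in> \<B>. \<forall>x\<in>B. \<forall>y\<in>B. dist x y < \<epsilon>}"
  have cover: "\<exists>B\<in>\<B>'. x \<in> B" for x
  proof -
    obtain B where B: "B \<in> \<B>" "x \<in> B" "B \<subseteq> ball x (\<epsilon>/2)"
      using \<epsilon>(1) by (metis topological_basisE[OF \<B>(2) open_ball] centre_in_ball half_gt_zero)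
    have "dist y z < \<epsilon>" if "y \<in> B" "z \<in> B" for y z
      using that B(3) by (meson dist_triangle_half_r mem_ball subsetD)
    then show ?thesis using B unfolding \<B>'_def by blast
  qed
  define B where "B = from_nat_into \<B>'"
  have "countable \<B>'" using \<B>(1) unfolding \<B>'_def by (rule countable_Collect)
  moreover have "\<B>' \<noteq> {}" using cover by blast
  ultimately have rB: "range B = \<B>'" unfolding B_def by (intro range_from_nat_into)
  have B: "open (B n)" and small: "x \<in> B n \<Longrightarrow> y \<in> B n \<Longrightarrow> dist x y < \<epsilon>" for n x y
    using rB topological_basis_open[OF \<B>(2)] unfolding \<B>'_def by blast+
  \<comment> \<open>When \<open>B n\<close> misses \<open>X\<close>, the first basic set that meets
    \<open>X\<close> is used as a default.\<close>
  define k where "k X n = (if X \<inter> B n \<noteq> {} then n else (LEAST j. X \<inter> B j \<noteq> {}))" for X n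
  define e where "e X n = (SOME x. x \<in> X \<inter> B (k X n))" for X n
  have unique: "x = y" if "X \<in> space (ultra_space D)" "x \<in> X \<inter> B n" "y \<in> X \<inter> B n" for X x y n
    using that small[of x n y] \<epsilon>(2)[of "dist x y"] by (force simp: space_ultra_space)
  have hit: "X \<inter> B (k X n) \<noteq> {}" if X: "X \<in> space (ultra_space D)" for X n
  proof -
    obtain x where "x \<in> X" using X unfolding space_ultra_space by blast
    then obtain j where "X \<inter> B j \<noteq> {}" using cover[of x] rB by blast
    then have "X \<inter> B (LEAST j. X \<inter> B j \<noteq> {}) \<noteq> {}" by (rule LeastI)
    then show ?thesis unfolding k_def by auto
  qed
  have e: "e X n \<in> X \<inter> B (k X n)" if "X \<in> space (ultra_space D)" for X n
    using hit[OF that] unfolding e_def by (metis ex_in_conv someI)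
  have "range (e X) = X" if X: "X \<in> space (ultra_space D)" for X
  proof
    show "range (e X) \<subseteq> X" using e[OF X] by auto
    show "X \<subseteq> range (e X)"
    proof
      fix x assume x: "x \<in> X"
      obtain n where n: "x \<in> B n" using cover[of x] rB by blast
      then have "k X n = n" using x unfolding k_def by auto
      then have "e X n = x" using unique[OF X] e[OF X, of n] x n by auto
      then show "x \<in> range (e X)" by auto
    qed
  qed
  moreover have "(\<lambda>X. e X n) \<in> borel_measurable (ultra_space D)" for n
  proof (rule borel_measurableI)
    fix V :: "'u set" assume "open V"
    \<comment> \<open>This unfolds \<open>LEAST\<close> into hits and misses of open sets, which are
      measurable conditions on \<open>X\<close>.\<close>
    have k_iff: "j = k X n \<longleftrightarrow> (if X \<inter> B n \<noteq> {} then j = n else X \<inter> B j \<noteq> {} \<and> (\<forall>i<j. \<not> X \<inter> B i \<noteq> {}))"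
      if "X \<in> space (ultra_space D)" for X j
    proof (cases "X \<inter> B n \<noteq> {}")
      case False
      have "X \<inter> B (LEAST j. X \<inter> B j \<noteq> {}) \<noteq> {}" using hit[OF that, of n] False unfolding k_def by auto
      then have "j = (LEAST j. X \<inter> B j \<noteq> {}) \<longleftrightarrow> X \<inter> B j \<noteq> {} \<and> (\<forall>i<j. \<not> X \<inter> B i \<noteq> {})"
        using not_less_Least[of _ "\<lambda>j. X \<inter> B j \<noteq> {}"] Least_le[of "\<lambda>j. X \<inter> B j \<noteq> {}" j]
        by (metis order_le_less)
      then show ?thesis using False unfolding k_def by auto
    qed (auto simp: k_def)
    define P where "P X \<longleftrightarrow> (\<exists>j. (if X \<inter> B n \<noteq> {} then j = n
        else X \<inter> B j \<noteq> {} \<and> (\<forall>i<j. \<not> X \<inter> B i \<noteq> {})) \<and> X \<inter> (B j \<inter> V) \<noteq> {})" for X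
    \<comment> \<open>As \<open>e X n\<close> is the only point of \<open>X\<close> in
      \<open>B (k X n)\<close>, it lies in \<open>V\<close> exactly if \<open>X\<close> meets
      \<open>B (k X n) \<inter> V\<close>.\<close>
    have "e X n \<in> V \<longleftrightarrow> P X" if X: "X \<in> space (ultra_space D)" for X
      unfolding P_def k_iff[OF X, symmetric] using e[OF X, of n] unique[OF X] by blast
    then have "(\<lambda>X. e X n) -` V \<inter> space (ultra_space D) = {X \<in> space (ultra_space D). P X}"
      by auto
    moreover have [measurable]: "Measurable.pred (ultra_space D) (\<lambda>X. X \<inter> B j \<noteq> {})"
      "Measurable.pred (ultra_space D) (\<lambda>X. X \<inter> (B j \<inter> V) \<noteq> {})" for j
      using B \<open>open V\<close> by (auto intro!: pred_ultra_space_hit)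
    have "Measurable.pred (ultra_space D) P"
      unfolding P_def by measurable
    ultimately show "(\<lambda>X. e X n) -` V \<inter> space (ultra_space D) \<in> sets (ultra_space D)"
      by (simp add: pred_def)
  qed
  ultimately show thesis by (rule that)
qed

section \<open>Isometric embeddability\<close>

lemma isometrically_embeds_refl: "X \<sqsubseteq>\<^sub>i X"
  unfolding isometrically_embeds_def by (intro exI[of _ id]) auto

lemma isometrically_embeds_trans:
  assumes "X \<sqsubseteq>\<^sub>i Y" "Y \<sqsubseteq>\<^sub>i Z"
  shows "X \<sqsubseteq>\<^sub>i Z"
proof -
  obtain f where "f ` X \<subseteq> Y" "\<forall>x\<in>X. \<forall>y\<in>X. dist (f x) (f y) = dist x y"
    using assms(1) unfolding isometrically_embeds_def by metis
  moreover obtain g where "g ` Y \<subseteq> Z" "\<forall>x\<in>Y. \<forall>y\<in>Y. dist (g x) (g y) = dist x y"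
    using assms(2) unfolding isometrically_embeds_def by metis
  ultimately show ?thesis
    unfolding isometrically_embeds_def by (intro exI[of _ "g \<circ> f"]) (auto simp: image_subset_iff)
qed

text \<open>An embedding may be given on indices even if \<open>x\<close> repeats points: equal
  values of \<open>x\<close> have distance 0, which forces equal values of \<open>y\<close>.\<close>

lemma isometrically_embeds_image:
  assumes dist_eq: "\<And>i j. i \<in> I \<Longrightarrow> j \<in> I \<Longrightarrow> dist (y i) (y j) = dist (x i) (x j)"
    and "y ` I \<subseteq> Y"
  shows "x ` I \<sqsubseteq>\<^sub>i Y"
proof -
  define c where "c a = (SOME i. i \<in> I \<and> x i = a)" for a
  have c: "c a \<in> I \<and> x (c a) = a" if "a \<in> x ` I" for a
    unfolding c_def by (rule someI_ex) (use that in auto)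
  then have "dist (y (c a)) (y (c b)) = dist a b" if "a \<in> x ` I" "b \<in> x ` I" for a b
    using dist_eq that by metis
  moreover have "(y \<circ> c) ` x ` I \<subseteq> Y" using c assms(2) by fastforce
  ultimately show ?thesis
    unfolding isometrically_embeds_def by (intro exI[of _ "y \<circ> c"]) simp
qed

lemma singleton_in_ultra_space: "0 \<in> D \<Longrightarrow> {v} \<in> space (ultra_space D)"
  by (auto simp: space_ultra_space ultrametric_on_def)

lemma singleton_isometrically_embeds: "X \<noteq> {} \<Longrightarrow> {v} \<sqsubseteq>\<^sub>i X"
  unfolding isometrically_embeds_def by (auto intro!: exI[of _ "\<lambda>_. SOME x. x \<in> X"] some_in_eq[THEN iffD2])

lemma not_isometrically_embeds_singleton:
  assumes "a \<in> X" "b \<in> X" "a \<noteq> b"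
  shows "\<not> X \<sqsubseteq>\<^sub>i {v}"
proof
  assume "X \<sqsubseteq>\<^sub>i {v}"
  then obtain f where "f ` X \<subseteq> {v}" "\<forall>x\<in>X. \<forall>y\<in>X. dist (f x) (f y) = dist x y"
    unfolding isometrically_embeds_def by blast
  then have "dist (f a) (f b) = dist a b" "f a = v" "f b = v" using assms by auto
  then show False using assms(3) by simp
qed

section \<open>Sums of sequences of spaces at a new largest distance\<close>

locale component_sums =
  fixes r :: "'o rel" and r' :: "'p rel" and D E :: "real set" and \<phi> :: "real \<Rightarrow> real" and m :: real
    and e :: "'u::polish_space set \<Rightarrow> nat \<Rightarrow> 'u"
  assumes urysohn: "urysohn_space TYPE('u)"
    and D: "distance_set r D" and E: "distance_set r' E"
    and \<phi>_in: "\<phi> ` D \<subseteq> E" and m_in: "m \<in> E" and \<phi>_0: "\<phi> 0 = 0"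
    and \<phi>_mono: "strict_mono_on D \<phi>" and \<phi>_less: "\<And>d. d \<in> D \<Longrightarrow> \<phi> d < m"
    and e_range: "\<And>X. X \<in> space (ultra_space D) \<Longrightarrow> range (e X) = X"
    and e_measurable: "\<And>n. (\<lambda>X. e X n) \<in> borel_measurable (ultra_space D)"
begin

abbreviation (input) "spaces \<equiv> space (ultra_space D) :: 'u set set"

lemma dist_in_D: "X \<in> spaces \<Longrightarrow> a \<in> X \<Longrightarrow> b \<in> X \<Longrightarrow> dist a b \<in> D"
  by (auto simp: space_ultra_space)

lemma e_in: "X \<in> spaces \<Longrightarrow> e X i \<in> X"
  using e_range by blast

lemma \<phi>_eq_iff: "c \<in> D \<Longrightarrow> d \<in> D \<Longrightarrow> \<phi> c = \<phi> d \<longleftrightarrow> c = d"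
  using \<phi>_mono by (metis strict_mono_on_eqD)

lemma \<phi>_le: "c \<in> D \<Longrightarrow> d \<in> D \<Longrightarrow> c \<le> d \<Longrightarrow> \<phi> c \<le> \<phi> d"
  using \<phi>_mono by (metis order_le_less strict_mono_onD)

lemma E_nonneg: "E \<subseteq> {0..}"
  using E by (simp add: distance_set_def)

text \<open>Index \<open>prod_encode (n, i)\<close> stands for the \<open>i\<close>-th listed point
  of the \<open>n\<close>-th summand. Distances inside a summand are moved by \<open>\<phi>\<close>
  into the part of \<open>E\<close> below \<open>m\<close>.\<close>

definition sum_dist :: "(nat \<Rightarrow> 'u set) \<Rightarrow> nat \<Rightarrow> nat \<Rightarrow> real" where
  "sum_dist s k l = (let (n, i) = prod_decode k; (n', j) = prod_decode l
     in if n = n' then \<phi> (dist (e (s n) i) (e (s n) j)) else m)"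

definition sum_space :: "(nat \<Rightarrow> 'u set) \<Rightarrow> 'u set" where
  "sum_space s = realization (sum_dist s)"

text \<open>The copy in the sum of the point \<open>snd p\<close> of the summand
  \<open>fst p\<close>. Another index listing the same point gives the same copy, since
  \<open>\<phi> 0 = 0\<close>.\<close>

definition inj_point :: "(nat \<Rightarrow> 'u set) \<Rightarrow> nat \<times> 'u \<Rightarrow> 'u" where
  "inj_point s p = point (sum_dist s) (prod_encode (fst p, SOME i. e (s (fst p)) i = snd p))"

text \<open>Within a summand the inequality passes through the monotone \<open>\<phi>\<close>;
  across summands it holds because \<open>m\<close> exceeds all distances inside a summand.\<close>

lemma sum_dist_pseudo_ultrametric:
  assumes s: "\<And>n. s n \<in> spaces"
  shows "pseudo_ultrametric E (sum_dist s)"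
proof -
  have in_D: "dist (e (s n) i) (e (s n) j) \<in> D" for n i j
    using s by (intro dist_in_D[of "s n"] e_in)
  have \<phi>: "\<phi> (dist (e (s n) i) (e (s n) k)) \<le>
      max (\<phi> (dist (e (s n) i) (e (s n) j))) (\<phi> (dist (e (s n) j) (e (s n) k)))" for n i j k
  proof -
    have "dist (e (s n) i) (e (s n) k) \<le> max (dist (e (s n) i) (e (s n) j)) (dist (e (s n) j) (e (s n) k))"
      using s[of n] e_in[OF s, of n] by (simp add: space_ultra_space ultrametric_on_def)
    then show ?thesis using \<phi>_le in_D by (metis le_max_iff_disj)
  qed
  have lt: "\<phi> (dist (e (s n) i) (e (s n) j)) < m" for n i j
    using \<phi>_less in_D by blast
  have "sum_dist s k1 k3 \<le> max (sum_dist s k1 k2) (sum_dist s k2 k3)" for k1 k2 k3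
    using \<phi> lt unfolding sum_dist_def
    by (auto split: prod.splits simp: less_imp_le le_max_iff_disj)
  moreover have "sum_dist s k l \<in> E" for k l
    using in_D \<phi>_in m_in unfolding sum_dist_def by (auto split: prod.splits)
  ultimately show ?thesis
    unfolding pseudo_ultrametric_def
    by (auto simp: sum_dist_def \<phi>_0 dist_commute split: prod.splits)
qed

lemma sum_space_in:
  "(\<And>n. s n \<in> spaces) \<Longrightarrow> sum_space s \<in> space (ultra_space E)"
  unfolding sum_space_def by (intro realization_in_ultra_space[OF urysohn E] sum_dist_pseudo_ultrametric)

lemma dist_inj_point:
  assumes s: "\<And>n. s n \<in> spaces" and "a \<in> s n" "b \<in> s n'"
  shows "dist (inj_point s (n, a)) (inj_point s (n', b)) = (if n = n' then \<phi> (dist a b) else m)"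
proof -
  have some: "e (s n) (SOME i. e (s n) i = a) = a" if a: "a \<in> s n" for n a
  proof -
    have "a \<in> range (e (s n))" using e_range[OF s, of n] a by simp
    then obtain i where "e (s n) i = a" by auto
    then show ?thesis by (rule someI)
  qed
  show ?thesis
    unfolding inj_point_def dist_point[OF urysohn sum_dist_pseudo_ultrametric[of s, OF s] E_nonneg]
    using some[OF assms(2)] some[OF assms(3)] by (auto simp: sum_dist_def)
qed

lemma sum_space_eq:
  assumes s: "\<And>n. s n \<in> spaces"
  shows "sum_space s = inj_point s ` (SIGMA n:UNIV. s n)"
proof
  show "inj_point s ` (SIGMA n:UNIV. s n) \<subseteq> sum_space s"
    by (auto simp: sum_space_def realization_def inj_point_def)
  show "sum_space s \<subseteq> inj_point s ` (SIGMA n:UNIV. s n)"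
  proof
    fix x assume "x \<in> sum_space s"
    then obtain n i where x: "x = point (sum_dist s) (prod_encode (n, i))"
      unfolding sum_space_def realization_def by (metis rangeE prod_decode_inverse surj_pair)
    have "e (s n) (SOME j. e (s n) j = e (s n) i) = e (s n) i"
      by (rule someI) simp
    then have "dist x (inj_point s (n, e (s n) i)) = 0"
      unfolding x inj_point_def dist_point[OF urysohn sum_dist_pseudo_ultrametric[of s, OF s] E_nonneg]
      by (simp add: sum_dist_def \<phi>_0)
    then show "x \<in> inj_point s ` (SIGMA n:UNIV. s n)"
      using e_in[OF s, of n i] by (auto intro!: image_eqI[of _ _ "(n, e (s n) i)"])
  qed
qed

text \<open>Two points share a summand iff their distance is below \<open>m\<close>. Hence an
  isometry sends each summand into one summand and different summands into different ones;
  injectivity of \<open>\<phi>\<close> on \<open>D\<close> restores the original distances.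
  Conversely, embeddings of the summands along an injection glue together.\<close>

lemma sum_space_embeds_iff:
  assumes s: "\<And>n. s n \<in> spaces" and t: "\<And>n. t n \<in> spaces"
  shows "sum_space s \<sqsubseteq>\<^sub>i sum_space t \<longleftrightarrow> (\<exists>g. inj g \<and> (\<forall>n. s n \<sqsubseteq>\<^sub>i t (g n)))"
proof
  assume "sum_space s \<sqsubseteq>\<^sub>i sum_space t"
  then obtain f where f: "f ` sum_space s \<subseteq> sum_space t"
    and iso: "\<And>x y. x \<in> sum_space s \<Longrightarrow> y \<in> sum_space s \<Longrightarrow> dist (f x) (f y) = dist x y"
    unfolding isometrically_embeds_def by blast
  have in_s: "inj_point s (n, a) \<in> sum_space s" if "a \<in> s n" for n a
    using that unfolding sum_space_eq[of s, OF s] by auto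
  have ex: "\<exists>p. snd p \<in> t (fst p) \<and> f (inj_point s (n, a)) = inj_point t p" if "a \<in> s n" for n a
  proof -
    have "f (inj_point s (n, a)) \<in> sum_space t" using f in_s[OF that] by auto
    then show ?thesis unfolding sum_space_eq[of t, OF t] by auto
  qed
  \<comment> \<open>The image of a point under \<open>f\<close> is split into its summand
    \<open>N n a\<close> and its position \<open>B n a\<close> there.\<close>
  define c where "c n a = (SOME p. snd p \<in> t (fst p) \<and> f (inj_point s (n, a)) = inj_point t p)" for n a
  define N where "N n a = fst (c n a)" for n a
  define B where "B n a = snd (c n a)" for n a
  have NB: "B n a \<in> t (N n a) \<and> f (inj_point s (n, a)) = inj_point t (N n a, B n a)" if "a \<in> s n" for n a
    using someI_ex[OF ex[OF that]] unfolding N_def B_def c_def by simp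
  have dist_eq: "(if N n a = N n' a' then \<phi> (dist (B n a) (B n' a')) else m) = (if n = n' then \<phi> (dist a a') else m)"
    if "a \<in> s n" "a' \<in> s n'" for n a n' a'
    using iso[OF in_s[OF that(1)] in_s[OF that(2)]] NB[OF that(1)] NB[OF that(2)] that
      dist_inj_point[of s, OF s] dist_inj_point[of t, OF t] by simp
  have lt: "\<phi> (dist a b) < m" if "X \<in> spaces" "a \<in> X" "b \<in> X" for X a b
    using that by (intro \<phi>_less dist_in_D)
  have same: "N n a = N n a'" if "a \<in> s n" "a' \<in> s n" for n a a'
    using dist_eq[OF that] lt[OF s that] by (auto split: if_splits)
  have diff: "N n a \<noteq> N n' a'" if "a \<in> s n" "a' \<in> s n'" "n \<noteq> n'" for n n' a a'
  proof
    assume eq: "N n a = N n' a'"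
    have "\<phi> (dist (B n a) (B n' a')) < m"
      by (rule lt[of "t (N n a)"]) (use t NB[OF that(1)] NB[OF that(2)] eq in auto)
    then show False using dist_eq[OF that(1,2)] eq that(3) by simp
  qed
  define a where "a n = (SOME x. x \<in> s n)" for n
  have a: "a n \<in> s n" for n
    using s[of n] unfolding a_def some_in_eq by (simp add: space_ultra_space)
  define g where "g n = N n (a n)" for n
  have "inj g"
  proof (rule injI)
    show "n = n'" if "g n = g n'" for n n'
      using diff[OF a[of n] a[of n']] that unfolding g_def by blast
  qed
  moreover have "s n \<sqsubseteq>\<^sub>i t (g n)" for n
    unfolding isometrically_embeds_def
  proof (intro exI[of _ "B n"] conjI ballI)
    have Ng: "N n x = g n" if "x \<in> s n" for x using same[OF that a] unfolding g_def by simp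
    then show Bt: "B n ` s n \<subseteq> t (g n)" using NB by fastforce
    fix x y assume xy: "x \<in> s n" "y \<in> s n"
    then have "\<phi> (dist (B n x) (B n y)) = \<phi> (dist x y)" using dist_eq[OF xy] Ng by simp
    then show "dist (B n x) (B n y) = dist x y"
      using \<phi>_eq_iff[of "dist (B n x) (B n y)" "dist x y"] dist_in_D[OF t[of "g n"]] dist_in_D[OF s[of n]] Bt xy
      by blast
  qed
  ultimately show "\<exists>g. inj g \<and> (\<forall>n. s n \<sqsubseteq>\<^sub>i t (g n))" by blast
next
  assume "\<exists>g. inj g \<and> (\<forall>n. s n \<sqsubseteq>\<^sub>i t (g n))"
  then obtain g where g: "inj g" "\<And>n. s n \<sqsubseteq>\<^sub>i t (g n)" by blast
  from g(2) obtain h where h: "\<And>n. h n ` s n \<subseteq> t (g n)"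
    "\<And>n x y. x \<in> s n \<Longrightarrow> y \<in> s n \<Longrightarrow> dist (h n x) (h n y) = dist x y"
    unfolding isometrically_embeds_def by metis
  have "dist (inj_point t (g (fst p), h (fst p) (snd p))) (inj_point t (g (fst q), h (fst q) (snd q))) =
      dist (inj_point s p) (inj_point s q)" if "p \<in> Sigma UNIV s" "q \<in> Sigma UNIV s" for p q
  proof -
    obtain n a n' b where pq: "p = (n, a)" "q = (n', b)" by (metis surj_pair)
    then have ab: "a \<in> s n" "b \<in> s n'" using that by auto
    then have "h n a \<in> t (g n)" "h n' b \<in> t (g n')" using h(1) by blast+
    then show ?thesis
      using dist_inj_point[of s, OF s ab] dist_inj_point[of t, OF t, of "h n a" "g n" "h n' b" "g n'"] h(2) ab
      unfolding pq by (auto simp: inj_eq[OF g(1)])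
  qed
  moreover have "(\<lambda>p. inj_point t (g (fst p), h (fst p) (snd p))) ` Sigma UNIV s \<subseteq> sum_space t"
    using h(1) unfolding sum_space_eq[of t, OF t] by fastforce
  ultimately show "sum_space s \<sqsubseteq>\<^sub>i sum_space t"
    unfolding sum_space_eq[of s, OF s] by (intro isometrically_embeds_image) auto
qed

lemma sum_space_measurable:
  assumes F: "\<And>n. F n \<in> N \<rightarrow>\<^sub>M ultra_space D"
  shows "(\<lambda>x. sum_space (\<lambda>n. F n x)) \<in> N \<rightarrow>\<^sub>M ultra_space E"
  unfolding sum_space_def
proof (rule realization_measurable[OF urysohn E])
  show "pseudo_ultrametric E (sum_dist (\<lambda>n. F n x))" if "x \<in> space N" for x
    using measurable_space[OF F that] by (intro sum_dist_pseudo_ultrametric)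
  show "{x \<in> space N. sum_dist (\<lambda>n. F n x) k l = d} \<in> sets N" for k l d
  proof -
    obtain n i n' j where kl: "prod_decode k = (n, i)" "prod_decode l = (n', j)" by (metis surj_pair)
    let ?d = "\<lambda>x. dist (e (F n x) i) (e (F n x) j)"
    have [measurable]: "?d \<in> borel_measurable N"
      using measurable_compose[OF F e_measurable] by (intro borel_measurable_dist)
    have "?d x \<in> D" if "x \<in> space N" for x
      using measurable_space[OF F that] by (intro dist_in_D[of "F n x"] e_in)
    \<comment> \<open>Countability of \<open>D\<close> reduces the level sets of the order-theoretic
      map \<open>\<phi>\<close> to countably many level sets of \<open>?d\<close>.\<close>
    then have "{x \<in> space N. \<phi> (?d x) = d} = (\<Union>c\<in>{c \<in> D. \<phi> c = d}. {x \<in> space N. ?d x = c})"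
      by auto
    moreover have "countable {c \<in> D. \<phi> c = d}"
      using D by (auto simp: distance_set_def)
    moreover have "{x \<in> space N. ?d x = c} \<in> sets N" for c by measurable
    ultimately have "{x \<in> space N. \<phi> (?d x) = d} \<in> sets N"
      by (auto intro!: sets.countable_UN')
    moreover have "sum_dist (\<lambda>n. F n x) k l = (if n = n' then \<phi> (?d x) else m)" for x
      unfolding sum_dist_def kl by simp
    ultimately show ?thesis
      by (cases "n = n'"; cases "m = d") simp_all
  qed
qed

lemma sum_space_two_points:
  assumes s: "\<And>n. s n \<in> spaces"
  obtains x y where "x \<in> sum_space s" "y \<in> sum_space s" "x \<noteq> y"
proof -
  define a where "a n = (SOME x. x \<in> s n)" for n
  have a: "a n \<in> s n" for n
    using s[of n] unfolding a_def some_in_eq by (simp add: space_ultra_space)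
  have "0 < m" using \<phi>_less[of 0] \<phi>_0 D by (simp add: distance_set_def)
  moreover have "dist (inj_point s (0, a 0)) (inj_point s (1, a 1)) = m"
    using dist_inj_point[of s, OF s a a] by simp
  ultimately have "inj_point s (0, a 0) \<noteq> inj_point s (1, a 1)" by force
  then show thesis
    using a by (intro that[of "inj_point s (0, a 0)" "inj_point s (1, a 1)"]) (auto simp: sum_space_eq[of s, OF s])
qed

end

section \<open>A greatest space with distances in a given set\<close>

text \<open>
  The finitely supported functions on \<open>D - {0}\<close>, at distance the largest point where they differ,
  form a countable universal ultrametric space.
\<close>

definition finite_words :: "real set \<Rightarrow> (real \<Rightarrow> nat) set" where
  "finite_words D = {g. finite {r. g r \<noteq> 0} \<and> {r. g r \<noteq> 0} \<subseteq> D - {0}}"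

definition word_dist :: "(real \<Rightarrow> nat) \<Rightarrow> (real \<Rightarrow> nat) \<Rightarrow> real" where
  "word_dist g h = Max (insert 0 {r. g r \<noteq> h r})"

text \<open>A word is determined by the finite graph of its nonzero values.\<close>

lemma countable_finite_words:
  assumes "countable D"
  shows "countable (finite_words D)"
proof (rule countable_image_inj_on)
  let ?G = "\<lambda>g :: real \<Rightarrow> nat. {(r, g r) | r. g r \<noteq> 0}"
  have "finite (?G g)" if "g \<in> finite_words D" for g
  proof -
    have "?G g = (\<lambda>r. (r, g r)) ` {r. g r \<noteq> 0}" by auto
    then show ?thesis using that by (simp add: finite_words_def)
  qed
  then have "?G ` finite_words D \<subseteq> {A. finite A \<and> A \<subseteq> D \<times> UNIV}"
    by (auto simp: finite_words_def)
  moreover have "countable {A. finite A \<and> A \<subseteq> D \<times> (UNIV :: nat set)}"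
    using assms by (intro countable_Collect_finite_subset) auto
  ultimately show "countable (?G ` finite_words D)" by (rule countable_subset)
  show "inj_on ?G (finite_words D)"
  proof (rule inj_onI, rule ext)
    fix g h r assume eq: "?G g = ?G h"
    have "(r, g r) \<in> ?G h" if "g r \<noteq> 0" using that eq by blast
    moreover have "(r, h r) \<in> ?G g" if "h r \<noteq> 0" using that eq by blast
    ultimately show "g r = h r" by (cases "g r = 0"; cases "h r = 0") auto
  qed
qed

context
  fixes D :: "real set"
  assumes D: "D \<subseteq> {0..}" "0 \<in> D"
begin

lemma finite_words_diff:
  assumes "g \<in> finite_words D" "h \<in> finite_words D"
  shows "finite {r. g r \<noteq> h r}" "{r. g r \<noteq> h r} \<subseteq> D - {0}"
proof -
  have "{r. g r \<noteq> h r} \<subseteq> {r. g r \<noteq> 0} \<union> {r. h r \<noteq> 0}" by auto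
  moreover have "finite ({r. g r \<noteq> 0} \<union> {r. h r \<noteq> 0})" "{r. g r \<noteq> 0} \<union> {r. h r \<noteq> 0} \<subseteq> D - {0}"
    using assms unfolding finite_words_def by auto
  ultimately show "finite {r. g r \<noteq> h r}" "{r. g r \<noteq> h r} \<subseteq> D - {0}"
    by (meson finite_subset subset_trans)+
qed

lemma word_dist_le_iff:
  assumes "g \<in> finite_words D" "h \<in> finite_words D" "0 \<le> r"
  shows "word_dist g h \<le> r \<longleftrightarrow> (\<forall>s>r. g s = h s)"
  using finite_words_diff(1)[OF assms(1,2)] assms(3) unfolding word_dist_def
  by (auto simp: not_less)

lemma word_dist_in: "g \<in> finite_words D \<Longrightarrow> h \<in> finite_words D \<Longrightarrow> word_dist g h \<in> D"
  using finite_words_diff[of g h] Max_in[of "insert 0 {r. g r \<noteq> h r}"] D unfolding word_dist_def by auto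

lemma word_dist_ge: "g \<in> finite_words D \<Longrightarrow> h \<in> finite_words D \<Longrightarrow> g r \<noteq> h r \<Longrightarrow> r \<le> word_dist g h"
  using finite_words_diff(1)[of g h] unfolding word_dist_def by auto

lemma word_dist_neq:
  assumes "g \<in> finite_words D" "h \<in> finite_words D" "0 < word_dist g h"
  shows "g (word_dist g h) \<noteq> h (word_dist g h)"
  using finite_words_diff(1)[OF assms(1,2)] Max_in[of "insert 0 {r. g r \<noteq> h r}"] assms(3)
  unfolding word_dist_def by auto

lemma word_dist_commute: "word_dist g h = word_dist h g"
  unfolding word_dist_def by metis

lemma word_dist_self: "word_dist g g = 0"
  unfolding word_dist_def by simp

lemma word_dist_ultra:
  assumes "f \<in> finite_words D" "g \<in> finite_words D" "h \<in> finite_words D"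
  shows "word_dist f h \<le> max (word_dist f g) (word_dist g h)"
proof -
  let ?r = "max (word_dist f g) (word_dist g h)"
  have "0 \<le> word_dist f g" "0 \<le> word_dist g h" using word_dist_in assms D by force+
  then have "\<forall>s>?r. f s = g s" "\<forall>s>?r. g s = h s"
    using word_dist_le_iff[of f g ?r] word_dist_le_iff[of g h ?r] assms by (auto simp: le_max_iff_disj)
  then show ?thesis
    using word_dist_le_iff[of f h ?r] assms \<open>0 \<le> word_dist f g\<close> by (auto simp: le_max_iff_disj)
qed

text \<open>Let \<open>x j\<close> be nearest to the new point, at distance \<open>r\<close>. If
  \<open>r = 0\<close>, its word is repeated. Otherwise the new word copies \<open>f j\<close> above
  \<open>r\<close>, takes a fresh value at \<open>r\<close> and vanishes below.\<close>

lemma finite_words_extension: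
  fixes n :: nat
  assumes X: "ultrametric_on X" "\<forall>x\<in>X. \<forall>y\<in>X. dist x y \<in> D" "range x \<subseteq> X"
    and f: "\<And>i. i < n \<Longrightarrow> f i \<in> finite_words D"
    "\<And>i j. i < n \<Longrightarrow> j < n \<Longrightarrow> word_dist (f i) (f j) = dist (x i) (x j)"
  shows "\<exists>t\<in>finite_words D. \<forall>i<n. word_dist (f i) t = dist (x i) (x n)"
proof (cases "n = 0")
  case True
  then show ?thesis by (intro bexI[of _ "\<lambda>_. 0"]) (auto simp: finite_words_def)
next
  case False
  define \<rho> where "\<rho> i = dist (x i) (x n)" for i
  have "\<exists>j. j < n \<and> (\<forall>i. i < n \<longrightarrow> \<rho> j \<le> \<rho> i)"
  proof -
    have "finite (\<rho> ` {..<n})" "\<rho> ` {..<n} \<noteq> {}" using False by auto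
    then have "Min (\<rho> ` {..<n}) \<in> \<rho> ` {..<n}" by (rule Min_in)
    then obtain j where "j < n" "\<rho> j = Min (\<rho> ` {..<n})" by auto
    then show ?thesis by auto
  qed
  then obtain j where j: "j < n" "\<And>i. i < n \<Longrightarrow> \<rho> j \<le> \<rho> i" by blast
  define r where "r = \<rho> j"
  have x: "x i \<in> X" for i using X(3) by auto
  have r: "r \<in> D" "0 \<le> r" unfolding r_def \<rho>_def using X(2) x by auto
  have tri: "dist (x i) (x j) \<le> \<rho> i" "\<rho> i \<le> max (dist (x i) (x j)) r" if "i < n" for i
  proof -
    have "dist (x i) (x j) \<le> max (dist (x i) (x n)) (dist (x n) (x j))"
      "dist (x i) (x n) \<le> max (dist (x i) (x j)) (dist (x j) (x n))"
      using X(1) x unfolding ultrametric_on_def by blast+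
    then show "dist (x i) (x j) \<le> \<rho> i" "\<rho> i \<le> max (dist (x i) (x j)) r"
      using j(2)[OF that] unfolding \<rho>_def r_def by (auto simp: dist_commute)
  qed
  show ?thesis
  proof (cases "r = 0")
    case True
    then have "x j = x n" unfolding r_def \<rho>_def by simp
    then show ?thesis using f j(1) by (intro bexI[of _ "f j"]) auto
  next
    case False
    \<comment> \<open>The successor of the sum exceeds each \<open>f i r\<close>, so the value at
      \<open>r\<close> is new.\<close>
    define t where "t s = (if r < s then f j s else if s = r then Suc (\<Sum>i<n. f i r) else 0)" for s
    have "{s. t s \<noteq> 0} \<subseteq> insert r {s. f j s \<noteq> 0}" unfolding t_def by auto
    moreover have "finite (insert r {s. f j s \<noteq> 0})" "insert r {s. f j s \<noteq> 0} \<subseteq> D - {0}"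
      using f(1)[OF j(1)] r False unfolding finite_words_def by auto
    ultimately have t: "t \<in> finite_words D"
      unfolding finite_words_def mem_Collect_eq by (meson finite_subset subset_trans)
    have t_r: "f i r \<noteq> t r" if "i < n" for i
    proof -
      have "f i r \<le> (\<Sum>i<n. f i r)" using that by (intro member_le_sum) auto
      then show ?thesis unfolding t_def by simp
    qed
    \<comment> \<open>If \<open>\<rho> i = r\<close>, the fresh value gives the distance. If
      \<open>\<rho> i > r\<close>, the ultrametric inequality makes \<open>x i\<close> equally far
      from \<open>x j\<close> and \<open>x n\<close>, and \<open>t\<close> agrees with
      \<open>f j\<close> at the largest place where \<open>f i\<close> and \<open>f j\<close>
      differ.\<close>
    have "word_dist (f i) t = \<rho> i" if i: "i < n" for i
    proof (rule antisym)
      have \<rho>r: "r \<le> \<rho> i" using j(2)[OF i] by (simp add: r_def)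
      have "word_dist (f i) (f j) \<le> \<rho> i" using f(2)[OF i j(1)] tri(1)[OF i] by simp
      then have "\<forall>s>\<rho> i. f i s = f j s"
        using word_dist_le_iff[OF f(1)[OF i] f(1)[OF j(1)], of "\<rho> i"] \<rho>r r by simp
      then have "\<forall>s>\<rho> i. f i s = t s" using \<rho>r unfolding t_def by simp
      then show "word_dist (f i) t \<le> \<rho> i"
        using word_dist_le_iff[OF f(1)[OF i] t, of "\<rho> i"] \<rho>r r by simp
      show "\<rho> i \<le> word_dist (f i) t"
      proof (cases "\<rho> i = r")
        case True
        then show ?thesis using word_dist_ge[OF f(1)[OF i] t t_r[OF i]] by simp
      next
        case False
        then have "word_dist (f i) (f j) = \<rho> i" "r < \<rho> i"
          using f(2)[OF i j(1)] tri[OF i] \<rho>r by auto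
        then have "f i (\<rho> i) \<noteq> t (\<rho> i)"
          using word_dist_neq[OF f(1)[OF i] f(1)[OF j(1)]] r unfolding t_def by auto
        then show ?thesis by (rule word_dist_ge[OF f(1)[OF i] t])
      qed
    qed
    then show ?thesis using t unfolding \<rho>_def by auto
  qed
qed

lemma finite_words_universal:
  assumes "ultrametric_on X" "\<forall>x\<in>X. \<forall>y\<in>X. dist x y \<in> D" "range x \<subseteq> X"
  obtains f :: "nat \<Rightarrow> real \<Rightarrow> nat" where "\<And>i. f i \<in> finite_words D"
    "\<And>i j. word_dist (f i) (f j) = dist (x i) (x j)"
proof -
  have "\<exists>f. \<forall>n. f n \<in> finite_words D \<and> (\<forall>i<n. word_dist (f i) (f n) = dist (x i) (x n))"
  proof (rule dependent_wellorder_choice)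
    fix n :: nat and f :: "nat \<Rightarrow> real \<Rightarrow> nat"
    assume IH: "\<And>k. k < n \<Longrightarrow> f k \<in> finite_words D \<and> (\<forall>i<k. word_dist (f i) (f k) = dist (x i) (x k))"
    have "word_dist (f i) (f j) = dist (x i) (x j)" if "i < n" "j < n" for i j
      using IH[OF that(1)] IH[OF that(2)] word_dist_self
      by (metis dist_commute dist_self linorder_neqE_nat word_dist_commute)
    then show "\<exists>t. t \<in> finite_words D \<and> (\<forall>i<n. word_dist (f i) t = dist (x i) (x n))"
      using finite_words_extension[of X x n f] assms IH by blast
  qed auto
  then obtain f where f: "\<And>n. f n \<in> finite_words D" "\<And>n i. i < n \<Longrightarrow> word_dist (f i) (f n) = dist (x i) (x n)"
    by blast
  have "word_dist (f i) (f j) = dist (x i) (x j)" for i j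
    using f(2) word_dist_self by (metis dist_commute dist_self linorder_neqE_nat word_dist_commute)
  with f(1) show thesis by (rule that)
qed

end

text \<open>The space is the realization of the finite words. That it attains every distance in
  \<open>D\<close> serves to keep it from embedding into a singleton as soon as \<open>D\<close> has
  a nonzero element.\<close>

lemma ultra_space_greatest:
  assumes U: "urysohn_space TYPE('u::polish_space)" and D: "distance_set r D"
  obtains T :: "'u::polish_space set" where "T \<in> space (ultra_space D)"
    "\<And>X. X \<in> space (ultra_space D) \<Longrightarrow> X \<sqsubseteq>\<^sub>i T"
    "\<And>d. d \<in> D \<Longrightarrow> \<exists>x\<in>T. \<exists>y\<in>T. dist x y = d"
proof -
  have D': "D \<subseteq> {0..}" "0 \<in> D" and "countable D"
    using D by (auto simp: distance_set_def)
  let ?W = "finite_words D"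
  have zero: "(\<lambda>_. 0) \<in> ?W" by (simp add: finite_words_def)
  have W: "countable ?W" using \<open>countable D\<close> by (rule countable_finite_words)
  define w where "w = from_nat_into ?W"
  have w_in: "w i \<in> ?W" for i
    unfolding w_def by (rule from_nat_into) (use zero in auto)
  define \<delta> where "\<delta> i j = word_dist (w i) (w j)" for i j
  have \<delta>: "pseudo_ultrametric D \<delta>"
    unfolding pseudo_ultrametric_def \<delta>_def
    using word_dist_self[OF D'] word_dist_commute[OF D'] word_dist_in[OF D' w_in w_in] word_dist_ultra[OF D' w_in w_in w_in]
    by metis
  let ?T = "realization \<delta> :: 'u set"
  have code: "\<exists>i. w i = g" if "g \<in> ?W" for g
    using W that unfolding w_def by (intro exI[of _ "to_nat_on ?W g"]) simp
  have emb: "X \<sqsubseteq>\<^sub>i ?T" if X: "X \<in> space (ultra_space D)" for X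
  proof -
    obtain e :: "'u set \<Rightarrow> nat \<Rightarrow> 'u" where "\<And>X. X \<in> space (ultra_space D) \<Longrightarrow> range (e X) = X"
      by (rule ultra_space_enumeration[OF D]) (rule that, blast)
    then have e: "range (e X) = X" using X .
    have X': "ultrametric_on X" "\<forall>x\<in>X. \<forall>y\<in>X. dist x y \<in> D" "range (e X) \<subseteq> X"
      using X e by (auto simp: space_ultra_space)
    obtain f where f: "\<And>i. f i \<in> ?W" "\<And>i j. word_dist (f i) (f j) = dist (e X i) (e X j)"
      by (rule finite_words_universal[OF D' X']) (rule that, assumption+)
    define c where "c i = (SOME j. w j = f i)" for i
    have c: "w (c i) = f i" for i
      unfolding c_def using code[OF f(1)] by (rule someI_ex)
    have "range (e X) \<sqsubseteq>\<^sub>i ?T"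
      by (rule isometrically_embeds_image[where y = "\<lambda>i. point \<delta> (c i)"])
         (auto simp: dist_point[OF U \<delta> D'(1)] \<delta>_def c f(2) realization_def)
    then show ?thesis using e by simp
  qed
  have "\<exists>x\<in>?T. \<exists>y\<in>?T. dist x y = d" if "d \<in> D" for d
  proof -
    \<comment> \<open>The word with its only nonzero value at \<open>d\<close> has distance
      \<open>d\<close> from the zero word; for \<open>d = 0\<close> it is the zero word
      itself.\<close>
    define g :: "real \<Rightarrow> nat" where "g = (\<lambda>r. if r = d \<and> d \<noteq> 0 then 1 else 0)"
    have g: "{r. g r \<noteq> 0} = (if d = 0 then {} else {d})" by (auto simp: g_def)
    then have "g \<in> ?W" using that by (auto simp: finite_words_def)
    then obtain i j where "w i = g" "w j = (\<lambda>_. 0)" using code[of g] code[OF zero] by blast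
    moreover have "word_dist g (\<lambda>_. 0) = d"
      using that D' unfolding word_dist_def g by (auto simp: max_def)
    ultimately have "dist (point \<delta> i :: 'u) (point \<delta> j) = d"
      by (simp add: dist_point[OF U \<delta> D'(1)] \<delta>_def)
    then show ?thesis unfolding realization_def by blast
  qed
  with realization_in_ultra_space[OF U D \<delta>] emb show thesis by (rule that)
qed

section \<open>The strict reduction\<close>

theorem theorem6p8:
  fixes \<alpha> :: "'o rel" and D E :: "real set"
  assumes "urysohn_space TYPE('u::polish_space)"
    and "Well_order \<alpha>" and "countable (Field \<alpha>)" and "Field \<alpha> \<noteq> {}"
    and "distance_set \<alpha> D" and "distance_set (ord_succ \<alpha>) E"
    and "borel_relation (ultra_space D :: 'u set measure) (\<sqsubseteq>\<^sub>i)"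
  shows "strictly_borel_reducible
           (ultra_space D :: 'u set measure) (\<sqsubseteq>\<^sub>i) (ultra_space E :: 'u set measure) (\<sqsubseteq>\<^sub>i)"
proof -
  let ?M = "ultra_space D :: 'u set measure" and ?N = "ultra_space E :: 'u set measure"
  obtain \<phi> m where \<phi>: "\<phi> ` D \<subseteq> E" "m \<in> E" "\<phi> 0 = 0" "strict_mono_on D \<phi>" "\<And>d. d \<in> D \<Longrightarrow> \<phi> d < m"
    using distance_set_succ[OF assms(5,6)] by metis
  obtain e :: "'u set \<Rightarrow> nat \<Rightarrow> 'u" where e: "\<And>X. X \<in> space ?M \<Longrightarrow> range (e X) = X"
    "\<And>n. (\<lambda>X. e X n) \<in> borel_measurable ?M"
    using ultra_space_enumeration[OF assms(5)] by metis
  interpret component_sums \<alpha> "ord_succ \<alpha>" D E \<phi> m e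
    by unfold_locales (fact assms \<phi> e)+
  have D0: "0 \<in> D" and E0: "0 \<in> E" using assms(5,6) by (auto simp: distance_set_def)
  have "sum_space (\<lambda>_. X) \<sqsubseteq>\<^sub>i sum_space (\<lambda>_. Y) \<longleftrightarrow> X \<sqsubseteq>\<^sub>i Y" if "X \<in> space ?M" "Y \<in> space ?M" for X Y
    using sum_space_embeds_iff[of "\<lambda>_. X" "\<lambda>_. Y"] that inj_on_id by auto
  moreover have "(\<lambda>X. sum_space (\<lambda>_. X)) \<in> ?M \<rightarrow>\<^sub>M ?N"
    by (rule sum_space_measurable) simp
  ultimately have "borel_reducible ?M (\<sqsubseteq>\<^sub>i) ?N (\<sqsubseteq>\<^sub>i)"
    unfolding borel_reducible_def by (intro bexI[of _ "\<lambda>X. sum_space (\<lambda>_. X)"]) auto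
  moreover have "\<not> borel_reducible ?N (\<sqsubseteq>\<^sub>i) ?M (\<sqsubseteq>\<^sub>i)"
  proof
    assume "borel_reducible ?N (\<sqsubseteq>\<^sub>i) ?M (\<sqsubseteq>\<^sub>i)"
    then obtain h where h: "h \<in> ?N \<rightarrow>\<^sub>M ?M"
      and h_iff: "\<And>X Y. X \<in> space ?N \<Longrightarrow> Y \<in> space ?N \<Longrightarrow> X \<sqsubseteq>\<^sub>i Y \<longleftrightarrow> h X \<sqsubseteq>\<^sub>i h Y"
      unfolding borel_reducible_def by blast
    \<comment> \<open>An arbitrary point, whose singleton is a least space.\<close>
    fix v :: 'u
    obtain T where T: "T \<in> space ?M" "\<And>X. X \<in> space ?M \<Longrightarrow> X \<sqsubseteq>\<^sub>i T" "\<And>d. d \<in> D \<Longrightarrow> \<exists>x\<in>T. \<exists>y\<in>T. dist x y = d"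
      using ultra_space_greatest[OF assms(1,5)] by metis
    show False
    \<comment> \<open>With 0 as the only distance, least and greatest spaces coincide up to
      embeddability and the jump argument has no start. But then all spaces over \<open>D\<close>
      embed into each other, whereas over \<open>E\<close> a sum does not embed into a
      point.\<close>
    proof (cases "D = {0}")
      case True
      have sub: "X \<sqsubseteq>\<^sub>i Y" if X: "X \<in> space ?M" and Y: "Y \<in> space ?M" for X Y
      proof -
        obtain a where "a \<in> X" using X unfolding space_ultra_space by blast
        moreover have "x = y" if "x \<in> X" "y \<in> X" for x y
          using dist_in_D[OF X that] True by simp
        ultimately have "X = {a}" by blast
        then show ?thesis using Y singleton_isometrically_embeds[of Y a] by (auto simp: space_ultra_space)
      qed
      let ?X = "sum_space (\<lambda>_. {v})"
      have v: "{v} \<in> space ?M" "{v} \<in> space ?N" using D0 E0 by (auto intro: singleton_in_ultra_space)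
      then have X: "?X \<in> space ?N" by (intro sum_space_in)
      have "\<not> ?X \<sqsubseteq>\<^sub>i {v}"
        using sum_space_two_points[of "\<lambda>_. {v}"] v(1) not_isometrically_embeds_singleton by metis
      then show False
        using h_iff[OF X v(2)] sub measurable_space[OF h] X v(2) by blast
    next
      case False
      then obtain d where d: "d \<in> D" "d \<noteq> 0" using D0 by auto
      \<comment> \<open>The assumed reduction \<open>h\<close> brings the sum back among the spaces
        over \<open>D\<close> while preserving the description of embeddings by injections.\<close>
      interpret absorbed_injective_jump ?M "(\<sqsubseteq>\<^sub>i)" "\<lambda>s. h (sum_space s)" "{v}" T
      proof
        show "\<not> T \<sqsubseteq>\<^sub>i {v}"
          using T(3)[OF d(1)] d(2) not_isometrically_embeds_singleton by (metis dist_self)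
        show "(\<lambda>x. h (sum_space (\<lambda>n. F n x))) \<in> borel \<rightarrow>\<^sub>M ?M"
          if "\<And>n. F n \<in> borel \<rightarrow>\<^sub>M ?M" for F :: "nat \<Rightarrow> (nat \<Rightarrow> real) \<Rightarrow> 'u set"
          using measurable_compose[OF sum_space_measurable[OF that] h] .
        show "h (sum_space s) \<sqsubseteq>\<^sub>i h (sum_space t) \<longleftrightarrow> (\<exists>f. inj f \<and> (\<forall>n. s n \<sqsubseteq>\<^sub>i t (f n)))"
          if "\<And>n. s n \<in> space ?M" "\<And>n. t n \<in> space ?M" for s t
          using h_iff[OF sum_space_in[of s] sum_space_in[of t]] sum_space_embeds_iff[of s t] that by simp
        show "h (sum_space s) \<in> space ?M" if "\<And>n. s n \<in> space ?M" for s
          using measurable_space[OF h sum_space_in[of s]] that by simp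
        show "{v} \<sqsubseteq>\<^sub>i x" if "x \<in> space ?M" for x
          using that singleton_isometrically_embeds unfolding space_ultra_space by blast
      qed (use T D0 isometrically_embeds_refl isometrically_embeds_trans singleton_in_ultra_space in blast)+
      show False using not_borel_relation assms(7) by contradiction
    qed
  qed
  ultimately show ?thesis unfolding strictly_borel_reducible_def by blast
qed

end
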